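(* Let $W_n=\max_{k\ge 0}Y_{n,k}$ be the width of a random recursive tree of $n$ nodes, where $Y_{n,k}$ is the number of nodes at distance $k$ from the root. For any $s\ge 0$, as $n\to\infty$, $$\mathbb{E}\{|W_n-\mathbb{E}\{W_n\}|^s\}=O\bigl(n^sL_n^{-3s/2}\bigr).$$
   Context: $L_n:=\max\{\log n,1\}$ (natural logarithm). A recursive tree of $n$ nodes is a rooted, nonplane tree with nodes labeled $1,\dots,n$ such that labels along every path down from the root are increasing; there are $(n-1)!$ of them. A random recursive tree of $n$ nodes is chosen uniformly among these. Equivalently: start with a root labeled $1$; for $i=2,\dots,n$, node $i$ is attached to a node chosen uniformly at random among the previous $i-1$ nodes. The root is at level $0$. *)

theory Defs
  imports "HOL-Probability.Probability" "HOL-Library.Landau_Symbols"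
begin

text \<open>A rooted tree is given by its parent-child pairs, so it carries no order on siblings.\<close>

definition rooted_tree :: "'a set \<Rightarrow> 'a \<Rightarrow> ('a \<times> 'a) set \<Rightarrow> bool" where
  "rooted_tree V r E \<longleftrightarrow>
     r \<in> V \<and> E \<subseteq> V \<times> V \<and> (\<forall>u. (u, r) \<notin> E) \<and>
     (\<forall>v\<in>V - {r}. \<exists>!u. (u, v) \<in> E) \<and> (\<forall>v\<in>V. (r, v) \<in> E\<^sup>*)"

text \<open>Since the labels increase along the path from the root to the node 1, the root is
  necessarily the node 1.\<close>

definition recursive_trees :: "nat \<Rightarrow> (nat \<times> nat) set set" where
  "recursive_trees n =
     {E. rooted_tree {1..n} 1 E \<and>
         (\<forall>xs. xs \<noteq> [] \<and> hd xs = 1 \<and> successively (\<lambda>u v. (u, v) \<in> E) xs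
            \<longrightarrow> sorted_wrt (<) xs)}"

definition random_recursive_tree :: "nat \<Rightarrow> (nat \<times> nat) set pmf" where
  "random_recursive_tree n = pmf_of_set (recursive_trees n)"

definition level :: "(nat \<times> nat) set \<Rightarrow> nat \<Rightarrow> nat" where
  "level E v = (LEAST k. (1, v) \<in> E ^^ k)"

definition profile :: "nat \<Rightarrow> (nat \<times> nat) set \<Rightarrow> nat \<Rightarrow> nat" where
  "profile n E k = card {v \<in> {1..n}. level E v = k}"

definition width :: "nat \<Rightarrow> (nat \<times> nat) set \<Rightarrow> nat" where
  "width n E = (MAX k. profile n E k)"

definition expected_width :: "nat \<Rightarrow> real" where
  "expected_width n =
     measure_pmf.expectation (random_recursive_tree n) (\<lambda>E. real (width n E))"

text \<open>Real powers of nonnegative numbers with the convention \<open>0\<^sup>0 = 1\<close>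
  (whereas \<open>0 powr 0 = 0\<close>).\<close>

definition rpow :: "real \<Rightarrow> real \<Rightarrow> real" where
  "rpow x s = (if s = 0 then 1 else x powr s)"

definition L :: "nat \<Rightarrow> real" where
  "L n = max (ln (real n)) 1"


lemma width_Max_well_defined: "finite (range (profile n E))"
proof -
  have "range (profile n E) \<subseteq> {..n}"
    unfolding profile_def by (auto intro: order.trans[OF card_mono[of "{1..n}"]])
  thus ?thesis by (rule finite_subset) simp
qed

lemma recursive_tree_iff:
  "E \<in> recursive_trees n \<longleftrightarrow> rooted_tree {1..n} 1 E \<and> (\<forall>(u, v)\<in>E. u < v)"
proof (intro iffI conjI)
  assume E: "E \<in> recursive_trees n"
  thus T: "rooted_tree {1..n} 1 E" by (simp add: recursive_trees_def)
  have path: "\<exists>xs. xs \<noteq> [] \<and> hd xs = 1 \<and> last xs = v \<and> successively (\<lambda>u v. (u, v) \<in> E) xs"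
    if "(1, v) \<in> E\<^sup>*" for v
    using that
  proof (induction rule: rtrancl_induct)
    case base
    show ?case by (intro exI[of _ "[1]"]) simp
  next
    case (step y z)
    then obtain xs where "xs \<noteq> []" "hd xs = 1" "last xs = y"
      "successively (\<lambda>u v. (u, v) \<in> E) xs" by blast
    thus ?case using step(2)
      by (intro exI[of _ "xs @ [z]"]) (auto simp: successively_append_iff)
  qed
  show "\<forall>(u, v)\<in>E. u < v"
  proof clarify
    fix u v assume uv: "(u, v) \<in> E"
    hence "(1, u) \<in> E\<^sup>*" using T by (auto simp: rooted_tree_def)
    then obtain xs where xs: "xs \<noteq> []" "hd xs = 1" "last xs = u"
      "successively (\<lambda>u v. (u, v) \<in> E) xs" using path by blast
    have "successively (\<lambda>u v. (u, v) \<in> E) (xs @ [v])"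
      using xs uv by (auto simp: successively_append_iff)
    hence "sorted_wrt (<) (xs @ [v])"
      using E xs unfolding recursive_trees_def by force
    thus "u < v" using xs last_in_set[of xs] by (auto simp: sorted_wrt_append)
  qed
next
  assume A: "rooted_tree {1..n} 1 E \<and> (\<forall>(u, v)\<in>E. u < v)"
  have "sorted_wrt (<) xs" if "successively (\<lambda>u v. (u, v) \<in> E) xs" for xs
  proof -
    have "successively (<) xs"
      using that A by (auto intro: successively_mono)
    thus ?thesis by (simp add: successively_conv_sorted_wrt)
  qed
  thus "E \<in> recursive_trees n" using A by (simp add: recursive_trees_def)
qed

text \<open>Equivalently, every node \<open>i \<ge> 2\<close> is attached to an arbitrary smaller node.\<close>

lemma recursive_trees_attachment:
  assumes "n \<ge> 1"
  shows "bij_betw (\<lambda>p. (\<lambda>i. (p i, i)) ` {2..n})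
           (PiE {2..n} (\<lambda>i. {1..<i})) (recursive_trees n)"
proof (rule bij_betw_imageI)
  show "inj_on (\<lambda>p. (\<lambda>i. (p i, i)) ` {2..n}) (PiE {2..n} (\<lambda>i. {1..<i}))"
  proof (rule inj_onI)
    fix p q assume pq: "p \<in> PiE {2..n} (\<lambda>i. {1..<i})" "q \<in> PiE {2..n} (\<lambda>i. {1..<i})"
      and eq: "(\<lambda>i. (p i, i)) ` {2..n} = (\<lambda>i. (q i, i)) ` {2..n}"
    show "p = q"
    proof (rule PiE_ext[OF pq])
      fix i assume "i \<in> {2..n}"
      hence "(p i, i) \<in> (\<lambda>i. (q i, i)) ` {2..n}" unfolding eq[symmetric] by blast
      thus "p i = q i" by auto
    qed
  qed
  show "(\<lambda>p. (\<lambda>i. (p i, i)) ` {2..n}) ` PiE {2..n} (\<lambda>i. {1..<i}) = recursive_trees n"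
  proof (intro set_eqI iffI)
    fix E assume "E \<in> (\<lambda>p. (\<lambda>i. (p i, i)) ` {2..n}) ` PiE {2..n} (\<lambda>i. {1..<i})"
    then obtain p where pE: "p \<in> PiE {2..n} (\<lambda>i. {1..<i})"
      and E: "E = (\<lambda>i. (p i, i)) ` {2..n}" by blast
    have p: "p i \<in> {1..<i}" if "i \<in> {2..n}" for i using pE that by (rule PiE_mem)
    have reach: "v \<in> {1..n} \<Longrightarrow> (1, v) \<in> E\<^sup>*" for v
    proof (induction v rule: less_induct)
      case (less v)
      show ?case
      proof (cases "v = 1")
        case False
        hence v: "v \<in> {2..n}" using less by auto
        have "(p v, v) \<in> E" using v E by auto
        moreover have "(1, p v) \<in> E\<^sup>*" using p[OF v] v by (intro less.IH) auto
        ultimately show ?thesis by (rule rtrancl_into_rtrancl[rotated])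
      qed simp
    qed
    have "rooted_tree {1..n} 1 E"
      unfolding rooted_tree_def
    proof (intro conjI ballI)
      show "E \<subseteq> {1..n} \<times> {1..n}" using p unfolding E by fastforce
      show "\<forall>u. (u, 1) \<notin> E" unfolding E by auto
      show "\<exists>!u. (u, v) \<in> E" if "v \<in> {1..n} - {1}" for v
        using that unfolding E by (intro ex1I[of _ "p v"]) auto
    qed (use assms reach in auto)
    moreover have "\<forall>(u, v)\<in>E. u < v" using p unfolding E by auto
    ultimately show "E \<in> recursive_trees n" by (simp add: recursive_tree_iff)
  next
    fix E assume "E \<in> recursive_trees n"
    hence T: "rooted_tree {1..n} 1 E" and inc: "\<And>u v. (u, v) \<in> E \<Longrightarrow> u < v"
      by (auto simp: recursive_tree_iff)
    define p where "p = restrict (\<lambda>i. THE u. (u, i) \<in> E) {2..n}"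
    have p: "(u, i) \<in> E \<longleftrightarrow> u = p i" if "i \<in> {2..n}" for u i
    proof -
      have "\<exists>!u. (u, i) \<in> E" using T that by (auto simp: rooted_tree_def)
      moreover from theI'[OF this] have "(p i, i) \<in> E" using that by (simp add: p_def)
      ultimately show ?thesis by blast
    qed
    have "p \<in> PiE {2..n} (\<lambda>i. {1..<i})"
    proof (rule PiE_I)
      fix i assume i: "i \<in> {2..n}"
      hence "(p i, i) \<in> E" using p by auto
      thus "p i \<in> {1..<i}" using T inc by (force simp: rooted_tree_def)
    qed (auto simp: p_def)
    moreover have "E = (\<lambda>i. (p i, i)) ` {2..n}"
    proof (intro set_eqI iffI; clarify)
      fix u i assume ui: "(u, i) \<in> E"
      hence "i \<in> {1..n}" "i \<noteq> 1" using T by (auto simp: rooted_tree_def)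
      hence "i \<in> {2..n}" by auto
      with ui p show "(u, i) \<in> (\<lambda>i. (p i, i)) ` {2..n}" by auto
    qed (use p in auto)
    ultimately show "E \<in> (\<lambda>p. (\<lambda>i. (p i, i)) ` {2..n}) ` PiE {2..n} (\<lambda>i. {1..<i})"
      by blast
  qed
qed

lemma card_recursive_trees:
  assumes "n \<ge> 1"
  shows "card (recursive_trees n) = fact (n - 1)"
proof -
  have "card (recursive_trees n) = card (PiE {2..n} (\<lambda>i. {1..<i}))"
    using bij_betw_same_card[OF recursive_trees_attachment[OF assms]] by simp
  also have "\<dots> = (\<Prod>i\<in>{2..n}. i - 1)" by (simp add: card_PiE)
  also have "\<dots> = (\<Prod>i\<in>{1..n - 1}. i)"
    by (rule prod.reindex_bij_witness[of _ "\<lambda>i. i + 1" "\<lambda>i. i - 1"]) auto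
  also have "\<dots> = fact (n - 1)" by (simp add: fact_prod)
  finally show ?thesis .
qed

end

theory Submission
  imports Defs
begin

text \<open>With \<open>Y(z)\<close> the level polynomial of the tree and \<open>P(z) = \<Prod>j=1..<n. (1 + z / j)\<close> its
  expectation, \<open>Y(z) / P(z)\<close> is a martingale. Its first-order expansion at \<open>z = 1\<close> is
  \<open>1 + (z - 1) m\<close>, where \<open>m\<close> is the centred mean level, and for \<open>z = e\<^sup>i\<^sup>t\<close> every even
  moment norm of \<open>Y - P - (z - 1) m P\<close> is \<open>O(t\<^sup>2 n exp(- c t\<^sup>2 ln n))\<close>. Integrating over \<open>t\<close> shows
  that the \<open>k\<close>-th coefficient of \<open>Y\<close> is \<open>\<mu>\<^sub>k - m (\<mu>\<^sub>k - \<mu>\<^sub>k\<^sub>-\<^sub>1)\<close> up to an error of order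
  \<open>n (ln n) powr (-3/2)\<close>, uniformly in \<open>k\<close>. Since the second differences of \<open>\<mu>\<close> are of the same
  order, the linear term merely shifts the profile and moves its maximum by only
  \<open>O((1 + m\<^sup>2) n (ln n) powr (-3/2))\<close>; the width is thus concentrated about \<open>max \<mu>\<close>.\<close>

section \<open>Averages over random recursive trees\<close>

text \<open>The linear term cannot be counted as error: the moments of m are bounded but do not tend
  to 0, and leaving the term in would replace t^2 by |t| in front of exp(-c t^2 ln n). The integral
  over t would then be of order 1/ln n instead of (ln n)^(-3/2). Single levels may well move that
  much; only the maximum does not.

  One estimate serves the whole circle: 1 - cos t >= t^2/12 on [-pi, pi] gives |P(e^(it))| <= n^(1 -
  t^2/48), so no range of t is treated apart. On the circle this exponent is at least 3/4, so
  squared norms may grow like n^(3/2), while polynomial moments of the levels cost at most n^(1/4).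
  The quotient n^(-5/4) is summable, and this closes the recursion in n.

  Even moments are used because |x + d|^(2(p+1)) is a power of the quadratic form |x + d|^2, whose
  part linear in d averages out. A real s is then reached from an even order above it.\<close>

definition mean :: "nat \<Rightarrow> ((nat \<times> nat) set \<Rightarrow> real) \<Rightarrow> real" where
  "mean n f = (\<Sum>E\<in>recursive_trees n. f E) / fact (n - 1)"

text \<open>Averaging over \<open>u\<close> is the uniform choice of the parent of node n + 1, hence
  the expectation conditional on the tree with n nodes.\<close>

definition avg :: "nat \<Rightarrow> (nat \<Rightarrow> real) \<Rightarrow> real" where
  "avg n g = (\<Sum>u=1..n. g u) / real n"

lemma finite_recursive_trees: "n \<ge> 1 \<Longrightarrow> finite (recursive_trees n)"
  using bij_betw_finite[OF recursive_trees_attachment[of n]] by (simp add: finite_PiE)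

lemma recursive_trees_nonempty: "n \<ge> 1 \<Longrightarrow> recursive_trees n \<noteq> {}"
  using card_recursive_trees[of n] by fastforce

lemma expectation_eq_mean:
  "n \<ge> 1 \<Longrightarrow> measure_pmf.expectation (random_recursive_tree n) f = mean n f"
  unfolding random_recursive_tree_def mean_def
  by (simp add: integral_pmf_of_set finite_recursive_trees recursive_trees_nonempty
      card_recursive_trees)

lemma mean_mono: "(\<And>E. E \<in> recursive_trees n \<Longrightarrow> f E \<le> g E) \<Longrightarrow> mean n f \<le> mean n g"
  unfolding mean_def by (intro divide_right_mono sum_mono) auto

lemma mean_nonneg: "(\<And>E. E \<in> recursive_trees n \<Longrightarrow> 0 \<le> f E) \<Longrightarrow> 0 \<le> mean n f"
  unfolding mean_def by (intro divide_nonneg_nonneg sum_nonneg) auto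

lemma mean_cong: "(\<And>E. E \<in> recursive_trees n \<Longrightarrow> f E = g E) \<Longrightarrow> mean n f = mean n g"
  unfolding mean_def by simp

lemma mean_add: "mean n (\<lambda>E. f E + g E) = mean n f + mean n g"
  unfolding mean_def by (simp add: sum.distrib add_divide_distrib)

lemma mean_cmult: "mean n (\<lambda>E. c * f E) = c * mean n f"
  unfolding mean_def by (simp add: sum_distrib_left)

lemma mean_const: "n \<ge> 1 \<Longrightarrow> mean n (\<lambda>E. c) = c"
  unfolding mean_def by (simp add: card_recursive_trees)

lemma avg_mono: "(\<And>u. u \<in> {1..n} \<Longrightarrow> f u \<le> g u) \<Longrightarrow> avg n f \<le> avg n g"
  unfolding avg_def by (intro divide_right_mono sum_mono) auto

lemma avg_cong: "(\<And>u. u \<in> {1..n} \<Longrightarrow> f u = g u) \<Longrightarrow> avg n f = avg n g"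
  unfolding avg_def by simp

lemma avg_add: "avg n (\<lambda>u. f u + g u) = avg n f + avg n g"
  unfolding avg_def by (simp add: sum.distrib add_divide_distrib)

lemma avg_cmult: "avg n (\<lambda>u. c * f u) = c * avg n f"
  unfolding avg_def by (simp add: sum_distrib_left)

lemma avg_const: "n \<ge> 1 \<Longrightarrow> avg n (\<lambda>u. c) = c"
  unfolding avg_def by simp

lemma avg_nonneg: "(\<And>u. u \<in> {1..n} \<Longrightarrow> 0 \<le> f u) \<Longrightarrow> 0 \<le> avg n f"
  unfolding avg_def by (intro divide_nonneg_nonneg sum_nonneg) auto

section \<open>Growing a recursive tree by one leaf\<close>

lemma recursive_tree_subset: "E \<in> recursive_trees n \<Longrightarrow> E \<subseteq> {1..n} \<times> {1..n}"
  by (simp add: recursive_tree_iff rooted_tree_def)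

lemma recursive_tree_insert:
  assumes "E \<in> recursive_trees n" "u \<in> {1..n}"
  shows "insert (u, Suc n) E \<in> recursive_trees (Suc n)"
proof -
  let ?E = "insert (u, Suc n) E"
  have T: "rooted_tree {1..n} 1 E" and less: "\<forall>(u, v)\<in>E. u < v"
    using assms(1) by (auto simp: recursive_tree_iff)
  have sub: "E \<subseteq> {1..n} \<times> {1..n}" and n: "n \<ge> 1"
    using T assms by (auto simp: rooted_tree_def)
  have reach: "(1, v) \<in> ?E\<^sup>*" if "v \<in> {1..n}" for v
  proof -
    have "(1, v) \<in> E\<^sup>*" using T that by (simp add: rooted_tree_def)
    thus ?thesis using rtrancl_mono[of E ?E] by blast
  qed
  have uE: "(u, Suc n) \<in> ?E" by simp
  have "rooted_tree {1..Suc n} 1 ?E"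
    unfolding rooted_tree_def
  proof (intro conjI ballI)
    show "?E \<subseteq> {1..Suc n} \<times> {1..Suc n}" using sub assms(2) by auto
    show "\<forall>u. (u, 1) \<notin> ?E" using T n by (auto simp: rooted_tree_def)
    show "(1, v) \<in> ?E\<^sup>*" if "v \<in> {1..Suc n}" for v
    proof (cases "v = Suc n")
      case True
      thus ?thesis using rtrancl_into_rtrancl[OF reach[OF assms(2)] uE] by simp
    qed (use reach that in auto)
    show "\<exists>!u. (u, v) \<in> ?E" if "v \<in> {1..Suc n} - {1}" for v
    proof (cases "v = Suc n")
      case True
      thus ?thesis using sub by auto
    next
      case False
      hence "\<exists>!u. (u, v) \<in> E" using T that by (auto simp: rooted_tree_def)
      thus ?thesis using False by auto
    qed
  qed auto
  thus ?thesis using less assms(2) by (auto simp: recursive_tree_iff)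
qed

text \<open>Injective, because the edge into node n + 1 and the remaining edges can be read off the
  result. Surjectivity follows by counting: both sides have n! elements.\<close>

lemma recursive_trees_Suc:
  assumes "n \<ge> 1"
  shows "bij_betw (\<lambda>(E, u). insert (u, Suc n) E) (recursive_trees n \<times> {1..n})
           (recursive_trees (Suc n))"
proof -
  let ?f = "\<lambda>(E, u). insert (u, Suc n) E" and ?A = "recursive_trees n \<times> {1..n}"
  have inj: "inj_on ?f ?A"
  proof (rule inj_onI, clarify)
    fix E u E' u'
    assume E: "E \<in> recursive_trees n" "E' \<in> recursive_trees n"
      and eq: "insert (u, Suc n) E = insert (u', Suc n) E'"
    have "E \<subseteq> {1..n} \<times> {1..n}" "E' \<subseteq> {1..n} \<times> {1..n}"
      using E recursive_tree_subset by auto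
    hence "(u, Suc n) \<notin> E" "(u, Suc n) \<notin> E'" "(u', Suc n) \<notin> E'" by auto
    thus "E = E' \<and> u = u'" using eq by (metis insertE insertI1 insert_ident prod.inject)
  qed
  have "?f ` ?A \<subseteq> recursive_trees (Suc n)"
    using recursive_tree_insert by auto
  moreover have "card (?f ` ?A) = card (recursive_trees (Suc n))"
    using assms card_image[OF inj]
    by (simp add: card_cartesian_product card_recursive_trees fact_reduce)
  ultimately have "?f ` ?A = recursive_trees (Suc n)"
    using finite_recursive_trees[of "Suc n"] by (intro card_subset_eq) auto
  with inj show ?thesis by (rule bij_betw_imageI)
qed

text \<open>Conditioning on the tree without its last node. All recursions in n, for means and for
  moments, start from this identity.\<close>

lemma mean_Suc:
  assumes "n \<ge> 1"
  shows "mean (Suc n) f = mean n (\<lambda>E. avg n (\<lambda>u. f (insert (u, Suc n) E)))"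
proof -
  have "(\<Sum>E\<in>recursive_trees (Suc n). f E)
      = (\<Sum>(E, u)\<in>recursive_trees n \<times> {1..n}. f (insert (u, Suc n) E))"
    using sum.reindex_bij_betw[OF recursive_trees_Suc[OF assms], of f]
    by (simp add: case_prod_unfold)
  also have "\<dots> = (\<Sum>E\<in>recursive_trees n. \<Sum>u\<in>{1..n}. f (insert (u, Suc n) E))"
    by (simp add: sum.cartesian_product)
  finally show ?thesis
    using assms by (simp add: mean_def avg_def sum_divide_distrib fact_reduce[of n] mult.commute)
qed

text \<open>The added edge ends in node n + 1, and no edge of \<open>E\<close> leaves that node, so
  a walk that ends in an old node cannot use it. Induction peels off the last edge, whose source is
  again old.\<close>

lemma relpow_insert_new_leaf:
  assumes "E \<subseteq> {1..n} \<times> {1..n}" "v \<le> n"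
  shows "(w, v) \<in> insert (u, Suc n) E ^^ k \<longleftrightarrow> (w, v) \<in> E ^^ k"
  using assms(2)
proof (induction k arbitrary: v)
  case (Suc k)
  have "(x, v) \<in> insert (u, Suc n) E \<longleftrightarrow> (x, v) \<in> E" for x using Suc.prems by auto
  moreover have "x \<le> n" if "(x, v) \<in> E" for x using that assms(1) by auto
  ultimately have "(x, v) \<in> insert (u, Suc n) E \<and> (w, x) \<in> insert (u, Suc n) E ^^ k
      \<longleftrightarrow> (x, v) \<in> E \<and> (w, x) \<in> E ^^ k" for x
    using Suc.IH[of x] by blast
  thus ?case unfolding relpow.simps relcomp_unfold by blast
qed auto

lemma level_insert_old:
  assumes "E \<in> recursive_trees n" "v \<in> {1..n}"
  shows "level (insert (u, Suc n) E) v = level E v"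
  using relpow_insert_new_leaf[OF recursive_tree_subset[OF assms(1)]] assms(2)
  by (simp add: level_def)

lemma level_insert_new:
  assumes "E \<in> recursive_trees n" "u \<in> {1..n}"
  shows "level (insert (u, Suc n) E) (Suc n) = Suc (level E u)"
proof -
  let ?E = "insert (u, Suc n) E"
  have sub: "E \<subseteq> {1..n} \<times> {1..n}" using recursive_tree_subset[OF assms(1)] .
  hence edge: "(w, Suc n) \<in> ?E \<longleftrightarrow> w = u" for w by auto
  have step: "(1, Suc n) \<in> ?E ^^ Suc k \<longleftrightarrow> (1, u) \<in> E ^^ k" for k
    using relpow_insert_new_leaf[OF sub, where v = u and w = 1 and u = u and k = k] assms(2) edge
    unfolding relpow.simps relcomp_unfold by auto
  have "(1, u) \<in> E\<^sup>*"
    using assms by (auto simp: recursive_tree_iff rooted_tree_def)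
  then obtain k where "(1, u) \<in> E ^^ k" by (auto simp: rtrancl_power)
  hence "(1, Suc n) \<in> ?E ^^ Suc k" using step by simp
  moreover have "(1, Suc n) \<notin> ?E ^^ 0" using assms(2) by auto
  ultimately have "(LEAST k. (1, Suc n) \<in> ?E ^^ k) = Suc (LEAST k. (1, Suc n) \<in> ?E ^^ Suc k)"
    by (rule Least_Suc)
  thus ?thesis by (simp only: level_def step)
qed

lemma recursive_trees_1: "recursive_trees 1 = {{}}"
proof -
  have "E = {}" if "E \<in> recursive_trees 1" for E
    using recursive_tree_subset[OF that] that by (fastforce simp: recursive_tree_iff)
  moreover have "{} \<in> recursive_trees 1"
    by (simp add: recursive_tree_iff rooted_tree_def)
  ultimately show ?thesis by blast
qed

lemma level_root: "level E 1 = 0"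
  by (simp add: level_def)

lemma sum_level_insert:
  fixes f :: "nat \<Rightarrow> 'a::comm_monoid_add"
  assumes "E \<in> recursive_trees n" "u \<in> {1..n}"
  shows "(\<Sum>v=1..Suc n. f (level (insert (u, Suc n) E) v))
       = (\<Sum>v=1..n. f (level E v)) + f (Suc (level E u))"
  using assms by (simp add: level_insert_old level_insert_new)

section \<open>Moments of centred sums\<close>

text \<open>To be read with P = |x|^2, Q = |d|^2 and P + w = |x + d|^2; the conditions on w are what
  the parallelogram law and Cauchy-Schwarz then give. The term linear in w is kept exactly, since
  averaging will reduce it to a multiple of Q. The induction multiplies by P + w.\<close>

lemma power_shift_bound:
  fixes p :: nat
  shows "\<exists>C>0. \<forall>P Q w :: real. P \<ge> 0 \<longrightarrow> Q \<ge> 0 \<longrightarrow> 0 \<le> P + w \<longrightarrow> P + w \<le> 2 * P + 2 * Q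
      \<longrightarrow> w\<^sup>2 \<le> 8 * P * Q + 2 * Q\<^sup>2
      \<longrightarrow> (P + w) ^ Suc p \<le> P ^ Suc p + real (Suc p) * P ^ p * w + C * (P ^ p * Q + Q ^ Suc p)"
proof (induction p)
  case 0
  show ?case by (rule exI[of _ 1]) auto
next
  case (Suc p)
  then obtain C where C: "C > 0" and IH: "\<And>P Q w :: real. P \<ge> 0 \<Longrightarrow> Q \<ge> 0 \<Longrightarrow> 0 \<le> P + w
      \<Longrightarrow> P + w \<le> 2 * P + 2 * Q \<Longrightarrow> w\<^sup>2 \<le> 8 * P * Q + 2 * Q\<^sup>2
      \<Longrightarrow> (P + w) ^ Suc p \<le> P ^ Suc p + real (Suc p) * P ^ p * w + C * (P ^ p * Q + Q ^ Suc p)"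
    by blast
  define C' where "C' = 10 * real (Suc p) + 6 * C"
  have "(P + w) ^ Suc (Suc p) \<le> P ^ Suc (Suc p) + real (Suc (Suc p)) * P ^ Suc p * w
      + C' * (P ^ Suc p * Q + Q ^ Suc (Suc p))"
    if *: "P \<ge> 0" "Q \<ge> 0" "0 \<le> P + w" "P + w \<le> 2 * P + 2 * Q" "w\<^sup>2 \<le> 8 * P * Q + 2 * Q\<^sup>2"
    for P Q w :: real
  proof -
    define S where "S = P ^ Suc p * Q + Q ^ Suc (Suc p)"
    have S1: "P ^ Suc p * Q \<le> S" "Q ^ Suc (Suc p) \<le> S"
      using * by (simp_all add: S_def)
    \<comment> \<open>The mixed monomials are dominated by one of the two extreme ones, according to
      whether P or Q is larger.\<close>
    have S2: "P ^ p * Q\<^sup>2 \<le> S"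
    proof (cases "Q \<le> P")
      case True
      hence "P ^ p * Q * Q \<le> P ^ p * Q * P" using * by (intro mult_left_mono) auto
      thus ?thesis using S1(1) by (simp add: power2_eq_square mult_ac)
    next
      case False
      hence "P ^ p * Q\<^sup>2 \<le> Q ^ p * Q\<^sup>2" using * by (intro mult_right_mono power_mono) auto
      thus ?thesis using S1(2) by (simp add: power2_eq_square mult_ac)
    qed
    have S3: "P * Q ^ Suc p \<le> S"
    proof (cases "Q \<le> P")
      case True
      hence "P * Q * Q ^ p \<le> P * Q * P ^ p" using * by (intro mult_left_mono power_mono) auto
      thus ?thesis using S1(1) by (simp add: mult_ac)
    next
      case False
      hence "P * Q ^ Suc p \<le> Q * Q ^ Suc p" using * by (intro mult_right_mono) auto
      thus ?thesis using S1(2) by simp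
    qed
    have "(P + w) ^ Suc (Suc p) = (P + w) * (P + w) ^ Suc p" by simp
    also have "\<dots> \<le> (P + w) * (P ^ Suc p + real (Suc p) * P ^ p * w + C * (P ^ p * Q + Q ^ Suc p))"
      by (rule mult_left_mono[OF IH]) (use * in auto)
    also have "\<dots> = P ^ Suc (Suc p) + real (Suc (Suc p)) * P ^ Suc p * w
        + (real (Suc p) * (P ^ p * w\<^sup>2) + (P + w) * (C * (P ^ p * Q + Q ^ Suc p)))"
      by (simp add: algebra_simps power2_eq_square)
    also have "real (Suc p) * (P ^ p * w\<^sup>2) \<le> real (Suc p) * (10 * S)"
    proof (rule mult_left_mono)
      have "P ^ p * w\<^sup>2 \<le> P ^ p * (8 * P * Q + 2 * Q\<^sup>2)" using * by (intro mult_left_mono) auto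
      also have "\<dots> = 8 * (P ^ Suc p * Q) + 2 * (P ^ p * Q\<^sup>2)" by (simp add: algebra_simps)
      finally show "P ^ p * w\<^sup>2 \<le> 10 * S" using S1 S2 by linarith
    qed simp
    also have "(P + w) * (C * (P ^ p * Q + Q ^ Suc p)) \<le> (2 * P + 2 * Q) * (C * (P ^ p * Q + Q ^ Suc p))"
      using * C by (intro mult_right_mono) auto
    also have "\<dots> = C * (2 * (P ^ Suc p * Q + P * Q ^ Suc p + P ^ p * Q\<^sup>2 + Q ^ Suc (Suc p)))"
      by (simp add: algebra_simps power2_eq_square)
    also have "\<dots> \<le> C * (6 * S)"
      using C S2 S3 unfolding S_def by (intro mult_left_mono) (simp_all add: algebra_simps)
    finally show ?thesis by (simp add: C'_def S_def algebra_simps)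
  qed
  moreover have "C' > 0" using C by (simp add: C'_def)
  ultimately show ?case by blast
qed

text \<open>The cross term 2 Re (cnj x d) in |x + d|^2 has average 0, so the linear term of
  \<open>power_shift_bound\<close> contributes only |d|^2.\<close>

lemma avg_cmod_shift_bound:
  fixes p :: nat
  shows "\<exists>C>0. \<forall>n\<ge>1. \<forall>(x::complex) d. (\<Sum>u=1..n. d u) = 0 \<longrightarrow>
     avg n (\<lambda>u. cmod (x + d u) ^ (2 * Suc p)) \<le> cmod x ^ (2 * Suc p)
       + C * (cmod x ^ (2 * p) * avg n (\<lambda>u. (cmod (d u))\<^sup>2) + avg n (\<lambda>u. cmod (d u) ^ (2 * Suc p)))"
proof -
  obtain C where C: "C > 0" and bound: "\<And>P Q w :: real. P \<ge> 0 \<Longrightarrow> Q \<ge> 0 \<Longrightarrow> 0 \<le> P + w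
      \<Longrightarrow> P + w \<le> 2 * P + 2 * Q \<Longrightarrow> w\<^sup>2 \<le> 8 * P * Q + 2 * Q\<^sup>2
      \<Longrightarrow> (P + w) ^ Suc p \<le> P ^ Suc p + real (Suc p) * P ^ p * w + C * (P ^ p * Q + Q ^ Suc p)"
    using power_shift_bound[of p] by blast
  have "avg n (\<lambda>u. cmod (x + d u) ^ (2 * Suc p)) \<le> cmod x ^ (2 * Suc p)
       + (C + Suc p) * (cmod x ^ (2 * p) * avg n (\<lambda>u. (cmod (d u))\<^sup>2) + avg n (\<lambda>u. cmod (d u) ^ (2 * Suc p)))"
    if n: "n \<ge> 1" and d: "(\<Sum>u=1..n. d u) = 0" for n x d
  proof -
    define P where "P = (cmod x)\<^sup>2"
    define Q where "Q u = (cmod (d u))\<^sup>2" for u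
    define r where "r u = 2 * Re (cnj x * d u)" for u
    have sq: "(cmod (x + d u))\<^sup>2 = P + (r u + Q u)" for u
      unfolding P_def Q_def r_def cmod_power2 by (simp add: power2_eq_square algebra_simps)
    have r2: "(r u)\<^sup>2 \<le> 4 * P * Q u" for u
    proof -
      have "\<bar>r u\<bar> \<le> 2 * (cmod x * cmod (d u))"
        using abs_Re_le_cmod[of "cnj x * d u"] by (simp add: r_def norm_mult)
      hence "\<bar>r u\<bar>\<^sup>2 \<le> (2 * (cmod x * cmod (d u)))\<^sup>2" by (intro power_mono) auto
      thus ?thesis by (simp add: P_def Q_def power_mult_distrib)
    qed
    have r1: "r u \<le> P + Q u" for u
    proof -
      have "r u \<le> 2 * (cmod x * cmod (d u))"
        using complex_Re_le_cmod[of "cnj x * d u"] by (simp add: r_def norm_mult)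
      also have "\<dots> \<le> P + Q u" using sum_squares_bound[of "cmod x" "cmod (d u)"]
        by (simp add: P_def Q_def mult_ac)
      finally show ?thesis .
    qed
    have PQ: "P \<ge> 0" "Q u \<ge> 0" for u by (simp_all add: P_def Q_def)
    have w2: "(r u + Q u)\<^sup>2 \<le> 8 * P * Q u + 2 * (Q u)\<^sup>2" for u
    proof -
      have "(r u + Q u)\<^sup>2 \<le> 2 * (r u)\<^sup>2 + 2 * (Q u)\<^sup>2"
        using sum_squares_bound[of "r u" "Q u"] by (simp add: power2_sum)
      thus ?thesis using r2[of u] by simp
    qed
    have main: "cmod (x + d u) ^ (2 * Suc p)
        \<le> (P ^ Suc p + (real (Suc p) * P ^ p) * r u) + ((real (Suc p) * P ^ p) * Q u + C * (P ^ p * Q u + Q u ^ Suc p))" for u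
    proof -
      have "cmod (x + d u) ^ (2 * Suc p) = (P + (r u + Q u)) ^ Suc p"
        unfolding power_mult sq ..
      also have "\<dots> \<le> P ^ Suc p + real (Suc p) * P ^ p * (r u + Q u) + C * (P ^ p * Q u + Q u ^ Suc p)"
        using PQ w2 r1[of u] sq[of u] zero_le_power2[of "cmod (x + d u)"] by (intro bound) auto
      finally show ?thesis by (simp add: algebra_simps)
    qed
    have r0: "avg n r = 0"
    proof -
      have "(\<Sum>u=1..n. r u) = 2 * Re (cnj x * (\<Sum>u=1..n. d u))"
        by (simp add: r_def sum_distrib_left)
      thus ?thesis unfolding avg_def d by simp
    qed
    have Qs: "cmod (d u) ^ (2 * Suc p) = Q u ^ Suc p" for u unfolding Q_def power_mult ..
    have Ps: "cmod x ^ (2 * k) = P ^ k" for k unfolding P_def power_mult ..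
    have nonneg: "avg n (\<lambda>u. Q u ^ Suc p) \<ge> 0" using PQ by (intro avg_nonneg) auto
    have "avg n (\<lambda>u. cmod (x + d u) ^ (2 * Suc p)) \<le>
       avg n (\<lambda>u. (P ^ Suc p + (real (Suc p) * P ^ p) * r u) + ((real (Suc p) * P ^ p) * Q u + C * (P ^ p * Q u + Q u ^ Suc p)))"
      by (intro avg_mono main)
    also have "\<dots> = P ^ Suc p + (real (Suc p) * P ^ p) * avg n Q + C * (P ^ p * avg n Q + avg n (\<lambda>u. Q u ^ Suc p))"
      unfolding avg_add avg_cmult avg_const[OF n] r0 by simp
    also have "\<dots> \<le> P ^ Suc p + (C + Suc p) * (P ^ p * avg n Q + avg n (\<lambda>u. Q u ^ Suc p))"
      using nonneg mult_nonneg_nonneg[OF of_nat_0_le_iff[of "Suc p"] nonneg] by (simp add: algebra_simps)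
    finally show ?thesis unfolding Qs Ps Q_def .
  qed
  moreover have "C + Suc p > 0" using C by simp
  ultimately show ?thesis by blast
qed

lemma power_add_superadditive:
  fixes a b :: real
  assumes "a \<ge> 0" "b \<ge> 0"
  shows "a ^ Suc p + b ^ Suc p \<le> (a + b) ^ Suc p" "a ^ Suc p + a ^ p * b \<le> (a + b) ^ Suc p"
proof -
  have "a ^ p \<le> (a + b) ^ p" "b ^ p \<le> (a + b) ^ p" using assms by (auto intro: power_mono)
  hence "a * a ^ p \<le> a * (a + b) ^ p" "b * b ^ p \<le> b * (a + b) ^ p" "b * a ^ p \<le> b * (a + b) ^ p"
    using assms by (auto intro: mult_left_mono)
  thus "a ^ Suc p + b ^ Suc p \<le> (a + b) ^ Suc p" "a ^ Suc p + a ^ p * b \<le> (a + b) ^ Suc p"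
    by (simp_all add: algebra_simps)
qed

lemma power_mult_le_add_power:
  fixes x y :: real
  assumes "x \<ge> 0" "y \<ge> 0"
  shows "x ^ p * y \<le> x ^ Suc p + y ^ Suc p"
proof (cases "x \<le> y")
  case True
  hence "x ^ p * y \<le> y ^ p * y" using assms by (intro mult_right_mono power_mono) auto
  moreover have "0 \<le> x ^ Suc p" using assms by simp
  ultimately show ?thesis by (simp add: mult_ac)
next
  case False
  hence "x ^ p * y \<le> x ^ p * x" using assms by (intro mult_left_mono) auto
  moreover have "0 \<le> y ^ Suc p" using assms by simp
  ultimately show ?thesis by (simp add: mult_ac)
qed

text \<open>A substitute for the Burkholder inequality: in the \<open>2 (p + 1)\<close>-th moment, adding a
  conditionally centred increment increases the squared norm at most additively.\<close>

lemma moment_step: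
  fixes p :: nat
  obtains C where "C > 0" and "\<And>n (X :: (nat \<times> nat) set \<Rightarrow> complex) d A D.
     n \<ge> 1 \<Longrightarrow> A > 0 \<Longrightarrow> D > 0 \<Longrightarrow>
     (\<And>E. E \<in> recursive_trees n \<Longrightarrow> (\<Sum>u=1..n. d E u) = 0) \<Longrightarrow>
     mean n (\<lambda>E. cmod (X E) ^ (2 * Suc p)) \<le> A ^ Suc p \<Longrightarrow>
     mean n (\<lambda>E. avg n (\<lambda>u. cmod (d E u) ^ (2 * Suc p))) \<le> D ^ Suc p \<Longrightarrow>
     mean n (\<lambda>E. avg n (\<lambda>u. cmod (X E + d E u) ^ (2 * Suc p))) \<le> (A + C * D) ^ Suc p"
proof -
  obtain C where C: "C > 0" and bound: "\<And>n x d. n \<ge> 1 \<Longrightarrow> (\<Sum>u=1..n. d u) = 0 \<Longrightarrow>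
     avg n (\<lambda>u. cmod (x + d u) ^ (2 * Suc p)) \<le> cmod x ^ (2 * Suc p)
       + C * (cmod x ^ (2 * p) * avg n (\<lambda>u. (cmod (d u))\<^sup>2) + avg n (\<lambda>u. cmod (d u) ^ (2 * Suc p)))"
    using avg_cmod_shift_bound[of p] by blast
  have *: "mean n (\<lambda>E. avg n (\<lambda>u. cmod (X E + d E u) ^ (2 * Suc p))) \<le> (A + (2 * C + (C + 1)) * D) ^ Suc p"
    if n: "n \<ge> 1" and A: "A > 0" and D: "D > 0"
      and d0: "\<And>E. E \<in> recursive_trees n \<Longrightarrow> (\<Sum>u=1..n. d E u) = 0"
      and mX: "mean n (\<lambda>E. cmod (X E) ^ (2 * Suc p)) \<le> A ^ Suc p"
      and mD: "mean n (\<lambda>E. avg n (\<lambda>u. cmod (d E u) ^ (2 * Suc p))) \<le> D ^ Suc p"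
    for n and X :: "(nat \<times> nat) set \<Rightarrow> complex" and d A D
  proof -
    define Y where "Y E = cmod (X E) ^ (2 * Suc p)" for E
    define V where "V E = avg n (\<lambda>u. cmod (d E u) ^ (2 * Suc p))" for E
    \<comment> \<open>Young's inequality after scaling |X|^2 by A and |d|^2 by D. Both terms on the
      right then have mean at most A^p D, which replaces an application of Hoelder.\<close>
    have young: "cmod (X E) ^ (2 * p) * avg n (\<lambda>u. (cmod (d E u))\<^sup>2)
        \<le> (D / A) * Y E + (A ^ p / D ^ p) * V E" for E
    proof -
      have pt: "cmod (X E) ^ (2 * p) * (cmod (d E u))\<^sup>2
          \<le> (D / A) * Y E + (A ^ p / D ^ p) * cmod (d E u) ^ (2 * Suc p)" for u
      proof -
        let ?x = "(cmod (X E))\<^sup>2 / A" and ?y = "(cmod (d E u))\<^sup>2 / D"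
        have "A ^ p * D * (?x ^ p * ?y) \<le> A ^ p * D * (?x ^ Suc p + ?y ^ Suc p)"
          using A D by (intro mult_left_mono power_mult_le_add_power) auto
        moreover have "A ^ p * D * (?x ^ p * ?y) = cmod (X E) ^ (2 * p) * (cmod (d E u))\<^sup>2"
        proof -
          have "a * D * (y / a * (v / D)) = y * v" if "a > 0" for a y v :: real
            using that D by simp
          from this[of "A ^ p"] show ?thesis using A unfolding power_mult power_divide by simp
        qed
        moreover have "A ^ p * D * (?x ^ Suc p + ?y ^ Suc p)
           = (D / A) * Y E + (A ^ p / D ^ p) * cmod (d E u) ^ (2 * Suc p)"
        proof -
          have "a * D * (y / (A * a) + v / (D * b)) = (D / A) * y + (a / b) * v"
            if "a > 0" "b > 0" for a b y v :: real
            using that A D by (simp add: field_simps)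
          from this[of "A ^ p" "D ^ p"] show ?thesis
            using A D unfolding Y_def power_mult power_divide power_Suc[of A] power_Suc[of D] by simp
        qed
        ultimately show ?thesis by simp
      qed
      have "cmod (X E) ^ (2 * p) * avg n (\<lambda>u. (cmod (d E u))\<^sup>2)
          = avg n (\<lambda>u. cmod (X E) ^ (2 * p) * (cmod (d E u))\<^sup>2)" by (rule avg_cmult[symmetric])
      also have "\<dots> \<le> avg n (\<lambda>u. (D / A) * Y E + (A ^ p / D ^ p) * cmod (d E u) ^ (2 * Suc p))"
        by (intro avg_mono pt)
      also have "\<dots> = (D / A) * Y E + (A ^ p / D ^ p) * V E"
        unfolding V_def avg_add avg_cmult avg_const[OF n] ..
      finally show ?thesis .
    qed
    have "mean n (\<lambda>E. avg n (\<lambda>u. cmod (X E + d E u) ^ (2 * Suc p)))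
        \<le> mean n (\<lambda>E. Y E + C * (((D / A) * Y E + (A ^ p / D ^ p) * V E) + V E))"
    proof (rule mean_mono)
      fix E assume E: "E \<in> recursive_trees n"
      have "avg n (\<lambda>u. cmod (X E + d E u) ^ (2 * Suc p))
          \<le> Y E + C * (cmod (X E) ^ (2 * p) * avg n (\<lambda>u. (cmod (d E u))\<^sup>2) + V E)"
        unfolding Y_def V_def by (rule bound[OF n d0[OF E]])
      also have "\<dots> \<le> Y E + C * (((D / A) * Y E + (A ^ p / D ^ p) * V E) + V E)"
        using C by (intro add_left_mono mult_left_mono add_right_mono young) auto
      finally show "avg n (\<lambda>u. cmod (X E + d E u) ^ (2 * Suc p)) \<le> \<dots>" .
    qed
    also have "\<dots> = mean n Y + C * (((D / A) * mean n Y + (A ^ p / D ^ p) * mean n V) + mean n V)"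
      unfolding mean_add mean_cmult ..
    also have "\<dots> \<le> A ^ Suc p + C * (((D / A) * A ^ Suc p + (A ^ p / D ^ p) * D ^ Suc p) + D ^ Suc p)"
      using mX mD A D C unfolding Y_def[symmetric] V_def[symmetric]
      by (intro add_mono mult_left_mono) auto
    also have "\<dots> = A ^ Suc p + A ^ p * (2 * C * D) + C * D ^ Suc p"
    proof -
      have "A * a + C * (((D / A) * (A * a) + (a / b) * (D * b)) + D * b) = A * a + a * (2 * C * D) + C * (D * b)"
        if "b > 0" for a b :: real
        using that A by (simp add: field_simps)
      from this[of "D ^ p"] show ?thesis using D by simp
    qed
    also have "\<dots> \<le> (A + 2 * C * D) ^ Suc p + ((C + 1) * D) ^ Suc p"
    proof (rule add_mono)
      show "A ^ Suc p + A ^ p * (2 * C * D) \<le> (A + 2 * C * D) ^ Suc p"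
        using A C D by (intro power_add_superadditive) auto
      \<comment> \<open>C itself may be below 1; C + 1 is at least 1, so its power of order p + 1
        still exceeds C.\<close>
      have "C * 1 \<le> (C + 1) * (C + 1) ^ p" using C by (intro mult_mono one_le_power) auto
      hence "C * D ^ Suc p \<le> (C + 1) ^ Suc p * D ^ Suc p"
        using D by (intro mult_right_mono) auto
      thus "C * D ^ Suc p \<le> ((C + 1) * D) ^ Suc p" by (simp only: power_mult_distrib)
    qed
    also have "\<dots> \<le> ((A + 2 * C * D) + (C + 1) * D) ^ Suc p"
      using A C D by (intro power_add_superadditive) auto
    finally show ?thesis by (simp add: algebra_simps)
  qed
  have "2 * C + (C + 1) > 0" using C by simp
  thus ?thesis by (rule that) (rule *)
qed

section \<open>Levels of random nodes\<close>

text \<open>Dividing the squared norm by n^(2 beta) removes the factors a n; by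
  \<open>moment_step\<close> it then grows by at most a constant times j^(-5/4) in step j, a
  summable amount. Abstract in X because it serves both \<open>remainder\<close> and
  \<open>depth_dev\<close>. C depends on p alone, which later gives uniformity in t.\<close>

lemma moment_recursion:
  fixes p :: nat
  obtains C where "C > 0" and "\<And>(X :: nat \<Rightarrow> (nat \<times> nat) set \<Rightarrow> complex) a d G \<beta> n.
     G > 0 \<Longrightarrow> (\<And>E. X 1 E = 0) \<Longrightarrow>
     (\<And>n E u. n \<ge> 1 \<Longrightarrow> E \<in> recursive_trees n \<Longrightarrow> u \<in> {1..n} \<Longrightarrow>
        X (Suc n) (insert (u, Suc n) E) = a n * X n E + d n E u) \<Longrightarrow>
     (\<And>n E. n \<ge> 1 \<Longrightarrow> E \<in> recursive_trees n \<Longrightarrow> (\<Sum>u=1..n. d n E u) = 0) \<Longrightarrow>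
     (\<And>n. n \<ge> 1 \<Longrightarrow> cmod (a n) \<le> (real (Suc n) / real n) powr \<beta>) \<Longrightarrow>
     (\<And>n. n \<ge> 1 \<Longrightarrow> mean n (\<lambda>E. avg n (\<lambda>u. cmod (d n E u) ^ (2 * Suc p)))
         \<le> (G * real (Suc n) powr (2 * \<beta>) * real n powr (-5/4)) ^ Suc p) \<Longrightarrow>
     n \<ge> 1 \<Longrightarrow> mean n (\<lambda>E. cmod (X n E) ^ (2 * Suc p)) \<le> (C * G * real n powr (2 * \<beta>)) ^ Suc p"
proof -
  obtain c where c: "c > 0" and step: "\<And>n (X :: (nat \<times> nat) set \<Rightarrow> complex) d A D.
     n \<ge> 1 \<Longrightarrow> A > 0 \<Longrightarrow> D > 0 \<Longrightarrow>
     (\<And>E. E \<in> recursive_trees n \<Longrightarrow> (\<Sum>u=1..n. d E u) = 0) \<Longrightarrow>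
     mean n (\<lambda>E. cmod (X E) ^ (2 * Suc p)) \<le> A ^ Suc p \<Longrightarrow>
     mean n (\<lambda>E. avg n (\<lambda>u. cmod (d E u) ^ (2 * Suc p))) \<le> D ^ Suc p \<Longrightarrow>
     mean n (\<lambda>E. avg n (\<lambda>u. cmod (X E + d E u) ^ (2 * Suc p))) \<le> (A + c * D) ^ Suc p"
    by (fact moment_step[of p])
  have summable: "summable (\<lambda>j. real j powr (-5/4))"
    by (simp add: summable_real_powr_iff)
  define S where "S n = (\<Sum>j=1..<n. real j powr (-5/4))" for n
  define T where "T = (\<Sum>j. real j powr (-5/4))"
  have S: "0 \<le> S n" "S n \<le> T" for n
    unfolding S_def T_def by (auto intro!: sum_nonneg sum_le_suminf simp: summable_real_powr_iff)
  have T0: "T \<ge> 0" using S[of 1] by linarith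
  define C where "C = 1 + c * T"
  have main: "mean N (\<lambda>E. cmod (X N E) ^ (2 * Suc p)) \<le> (C * G * real N powr (2 * \<beta>)) ^ Suc p"
    if G: "G > 0" and X1: "\<And>E. X 1 E = 0"
      and rec: "\<And>n E u. n \<ge> 1 \<Longrightarrow> E \<in> recursive_trees n \<Longrightarrow> u \<in> {1..n} \<Longrightarrow>
        X (Suc n) (insert (u, Suc n) E) = a n * X n E + d n E u"
      and d0: "\<And>n E. n \<ge> 1 \<Longrightarrow> E \<in> recursive_trees n \<Longrightarrow> (\<Sum>u=1..n. d n E u) = 0"
      and a: "\<And>n. n \<ge> 1 \<Longrightarrow> cmod (a n) \<le> (real (Suc n) / real n) powr \<beta>"
      and d: "\<And>n. n \<ge> 1 \<Longrightarrow> mean n (\<lambda>E. avg n (\<lambda>u. cmod (d n E u) ^ (2 * Suc p)))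
         \<le> (G * real (Suc n) powr (2 * \<beta>) * real n powr (-5/4)) ^ Suc p"
      and N: "N \<ge> 1"
    for X :: "nat \<Rightarrow> (nat \<times> nat) set \<Rightarrow> complex" and a d G \<beta> N
  proof -
    \<comment> \<open>The summand 1 keeps A positive at n = 1, as \<open>moment_step\<close>
      demands, although X 1 is 0.\<close>
    define A where "A n = G * real n powr (2 * \<beta>) * (1 + c * S n)" for n
    have Apos: "A n > 0" if "n \<ge> 1" for n
      unfolding A_def using that G c S(1)[of n]
      by (intro mult_pos_pos add_pos_nonneg mult_nonneg_nonneg) auto
    have bound: "mean n (\<lambda>E. cmod (X n E) ^ (2 * Suc p)) \<le> A n ^ Suc p" if "n \<ge> 1" for n
      using that
    proof (induction n rule: nat_induct_at_least)
      case base
      show ?case using Apos[of 1] unfolding X1 by (simp add: mean_def)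
    next
      case (Suc n)
      define r where "r = (real (Suc n) / real n) powr (2 * \<beta>)"
      define D where "D = G * real (Suc n) powr (2 * \<beta>) * real n powr (-5/4)"
      have r0: "r > 0" and D0: "D > 0" using Suc.hyps G by (simp_all add: r_def D_def)
      have "(cmod (a n))\<^sup>2 \<le> ((real (Suc n) / real n) powr \<beta>)\<^sup>2"
        using a[OF Suc.hyps] by (intro power_mono) auto
      also have "\<dots> = r" unfolding r_def
        by (subst powr_power) (use Suc.hyps in \<open>auto simp: mult.commute\<close>)
      finally have a2: "(cmod (a n))\<^sup>2 \<le> r" .
      have aX: "mean n (\<lambda>E. cmod (a n * X n E) ^ (2 * Suc p)) \<le> (r * A n) ^ Suc p"
      proof -
        have "mean n (\<lambda>E. cmod (a n * X n E) ^ (2 * Suc p))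
            = ((cmod (a n))\<^sup>2) ^ Suc p * mean n (\<lambda>E. cmod (X n E) ^ (2 * Suc p))"
          unfolding norm_mult power_mult_distrib mean_cmult power_mult ..
        also have "\<dots> \<le> r ^ Suc p * A n ^ Suc p"
          using a2 Suc.IH r0 by (intro mult_mono power_mono mean_nonneg) auto
        finally show ?thesis by (simp only: power_mult_distrib)
      qed
      have "mean (Suc n) (\<lambda>E. cmod (X (Suc n) E) ^ (2 * Suc p))
          = mean n (\<lambda>E. avg n (\<lambda>u. cmod (a n * X n E + d n E u) ^ (2 * Suc p)))"
        unfolding mean_Suc[OF Suc.hyps]
        by (intro mean_cong avg_cong) (simp add: rec[OF Suc.hyps])
      also have "\<dots> \<le> (r * A n + c * D) ^ Suc p"
        by (rule step) (use Suc.hyps r0 D0 Apos d0 d aX in \<open>auto simp: D_def\<close>)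
      also have "r * A n + c * D = A (Suc n)"
      proof -
        have "S (Suc n) = S n + real n powr (-5/4)" using Suc.hyps by (simp add: S_def)
        moreover have "r * real n powr (2 * \<beta>) = real (Suc n) powr (2 * \<beta>)"
          unfolding r_def using Suc.hyps by (simp add: powr_divide)
        ultimately show ?thesis by (simp add: A_def D_def algebra_simps)
      qed
      finally show ?case .
    qed
    have "A n ^ Suc p \<le> (C * G * real n powr (2 * \<beta>)) ^ Suc p" if "n \<ge> 1" for n
    proof (rule power_mono)
      have "c * S n \<le> c * T" using S c by (intro mult_left_mono) auto
      hence "G * real n powr (2 * \<beta>) * (1 + c * S n) \<le> G * real n powr (2 * \<beta>) * C"
        using G unfolding C_def by (intro mult_left_mono) auto
      thus "A n \<le> C * G * real n powr (2 * \<beta>)" by (simp add: A_def mult_ac)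
    qed (use Apos that in \<open>simp add: less_imp_le\<close>)
    from order_trans[OF bound[OF N] this[OF N]] show ?thesis .
  qed
  have "C > 0" unfolding C_def using c T0 by (intro add_pos_nonneg) auto
  thus ?thesis by (rule that) (rule main)
qed

section \<open>Level polynomials and polynomial moments of the levels\<close>

lemma power_le_exponential:
  fixes a :: real
  assumes "a > 1"
  shows "\<exists>K>0. \<forall>l. (1 + real l) ^ q \<le> K * a ^ l"
  using assms
proof (induction q arbitrary: a)
  case 0
  thus ?case by (intro exI[of _ 1]) (simp add: one_le_power)
next
  case (Suc q)
  \<comment> \<open>Base sqrt a is spent twice: once on a single factor 1 + l, by Bernoulli, and
    once on the other q factors, by induction.\<close>
  define b where "b = sqrt a"
  have b: "b > 1" "b * b = a" using Suc.prems by (auto simp: b_def)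
  obtain K where K: "K > 0" "\<And>l. (1 + real l) ^ q \<le> K * b ^ l" using Suc.IH[OF b(1)] by blast
  define c where "c = 1 / min 1 (b - 1)"
  have c: "c > 0" using b by (auto simp: c_def)
  have lin: "1 + real l \<le> c * b ^ l" for l
  proof -
    have "min 1 (b - 1) * (1 + real l) = min 1 (b - 1) + min 1 (b - 1) * real l"
      by (simp add: algebra_simps)
    also have "\<dots> \<le> 1 + (b - 1) * real l"
      by (intro add_mono mult_right_mono) auto
    also have "\<dots> \<le> b ^ l" using Bernoulli_inequality[of "b - 1" l] b by (simp add: mult.commute)
    finally show ?thesis using b by (simp add: c_def field_simps)
  qed
  have "(1 + real l) ^ Suc q \<le> (c * K) * a ^ l" for l
  proof -
    have "(1 + real l) * (1 + real l) ^ q \<le> (c * b ^ l) * (K * b ^ l)"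
      using lin[of l] K c b by (intro mult_mono) auto
    thus ?thesis unfolding b(2)[symmetric] by (simp add: power_mult_distrib mult_ac)
  qed
  thus ?case using c K by (intro exI[of _ "c * K"]) auto
qed

text \<open>Generic in the type, as it is evaluated at the real point 5/4 to control levels and at
  \<open>cis t\<close> to reach the profile.\<close>

definition level_poly :: "nat \<Rightarrow> (nat \<times> nat) set \<Rightarrow> 'a \<Rightarrow> 'a::comm_semiring_1" where
  "level_poly n E z = (\<Sum>v=1..n. z ^ level E v)"

definition mean_poly :: "nat \<Rightarrow> 'a \<Rightarrow> 'a::field_char_0" where
  "mean_poly n z = (\<Prod>j=1..<n. 1 + z / of_nat j)"

lemma level_poly_insert:
  "E \<in> recursive_trees n \<Longrightarrow> u \<in> {1..n} \<Longrightarrow>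
   level_poly (Suc n) (insert (u, Suc n) E) z = level_poly n E z + z ^ Suc (level E u)"
  unfolding level_poly_def by (rule sum_level_insert)

lemma mean_poly_Suc: "n \<ge> 1 \<Longrightarrow> mean_poly (Suc n) z = (1 + z / of_nat n) * mean_poly n z"
  unfolding mean_poly_def by simp

text \<open>A new node lies one level below a uniform parent, so on average it adds x/n times the
  old polynomial, which is one more factor of \<open>mean_poly\<close>.\<close>

lemma mean_level_poly: "n \<ge> 1 \<Longrightarrow> mean n (\<lambda>E. level_poly n E x) = mean_poly n x"
proof (induction n rule: nat_induct_at_least)
  case base
  show ?case unfolding mean_def recursive_trees_1 level_poly_def mean_poly_def
    by (simp add: level_root[simplified])
next
  case (Suc n)
  have "mean (Suc n) (\<lambda>E. level_poly (Suc n) E x)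
      = mean n (\<lambda>E. avg n (\<lambda>u. level_poly n E x + x * x ^ level E u))"
    unfolding mean_Suc[OF Suc.hyps]
    by (intro mean_cong avg_cong) (simp add: level_poly_insert)
  also have "\<dots> = mean n (\<lambda>E. (1 + x / n) * level_poly n E x)"
    unfolding avg_add avg_const[OF Suc.hyps] avg_cmult
    using Suc.hyps by (intro mean_cong) (simp add: avg_def level_poly_def field_simps)
  also have "\<dots> = mean_poly (Suc n) x"
    unfolding mean_cmult Suc.IH mean_poly_Suc[OF Suc.hyps] ..
  finally show ?case .
qed

text \<open>Bernoulli's inequality 1 + 5y/4 <= (1 + y)^(5/4) with y = 1/j bounds each factor, and
  the bounds telescope.\<close>

lemma mean_poly_five_quarters_le: "n \<ge> 1 \<Longrightarrow> mean_poly n (5/4) \<le> real n powr (5/4)"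
proof (induction n rule: nat_induct_at_least)
  case base
  show ?case by (simp add: mean_poly_def)
next
  case (Suc n)
  define y where "y = 1 / real n"
  have y: "y > 0" using Suc.hyps by (simp add: y_def)
  \<comment> \<open>Fourth powers clear the roots; with y = 4x the difference is a polynomial with
    nonnegative coefficients.\<close>
  have "(1 + 5/4 * y) ^ 4 \<le> (1 + y) ^ 5"
  proof -
    have "(1 + 4 * x) ^ 5 = (1 + 5 * x) ^ 4 + (10 * x^2 + 140 * x^3 + 655 * x^4 + 1024 * x^5)"
      for x :: real by algebra
    from this[of "y / 4"] show ?thesis using y by simp
  qed
  hence "((1 + 5/4 * y) ^ 4) powr (1/4) \<le> ((1 + y) ^ 5) powr (1/4)"
    using y by (intro powr_mono2) auto
  moreover have "(x ^ 4) powr (1/4) = x" "(x ^ 5) powr (1/4) = x powr (5/4)" if "x > 0" for x :: real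
  proof -
    have "x ^ 4 = x powr 4" "x ^ 5 = x powr 5" using that by simp_all
    thus "(x ^ 4) powr (1/4) = x" "(x ^ 5) powr (1/4) = x powr (5/4)"
      using that by (simp_all only: powr_powr) simp_all
  qed
  ultimately have le: "1 + 5/4 * y \<le> (1 + y) powr (5/4)" using y by simp
  have "mean_poly n (5/4 :: real) \<ge> 0" by (simp add: mean_poly_def prod_nonneg)
  have "mean_poly (Suc n) (5/4) = (1 + 5/4 * y) * mean_poly n (5/4)"
    using mean_poly_Suc[OF Suc.hyps, of "5/4 :: real"] by (simp add: y_def)
  also have "\<dots> \<le> (1 + y) powr (5/4) * real n powr (5/4)"
    using le y Suc.IH \<open>mean_poly n (5/4) \<ge> 0\<close> by (intro mult_mono) auto
  also have "\<dots> = ((1 + y) * real n) powr (5/4)" using y by (simp add: powr_mult)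
  also have "(1 + y) * real n = real (Suc n)" using Suc.hyps by (simp add: y_def field_simps)
  finally show ?case .
qed

text \<open>Powers of the level are dominated by (5/4)^level, whose mean is
  \<open>mean_poly n (5/4)\<close> / n. The true order is a power of ln n, but n^(1/4) is enough for
  the recursion.\<close>

lemma level_moment:
  "\<exists>K>0. \<forall>n\<ge>1. mean n (\<lambda>E. avg n (\<lambda>u. (1 + real (level E u)) ^ q)) \<le> K * real n powr (1/4)"
proof -
  obtain K where K: "K > 0" "\<And>l. (1 + real l) ^ q \<le> K * (5/4) ^ l"
    using power_le_exponential[of "5/4" q] by auto
  have "mean n (\<lambda>E. avg n (\<lambda>u. (1 + real (level E u)) ^ q)) \<le> K * real n powr (1/4)"
    if n: "n \<ge> 1" for n
  proof -
    have "mean n (\<lambda>E. avg n (\<lambda>u. (1 + real (level E u)) ^ q))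
        \<le> mean n (\<lambda>E. avg n (\<lambda>u. K * (5/4) ^ level E u))"
      by (intro mean_mono avg_mono K)
    also have "\<dots> = mean n (\<lambda>E. K / real n * level_poly n E (5/4))"
      unfolding avg_cmult by (intro mean_cong) (simp add: avg_def level_poly_def)
    also have "\<dots> = K / real n * mean_poly n (5/4)"
      unfolding mean_cmult mean_level_poly[OF n] ..
    also have "\<dots> \<le> K / real n * real n powr (5/4)"
      using K n by (intro mult_left_mono mean_poly_five_quarters_le) auto
    also have "\<dots> = K * (real n powr (5/4) / real n powr 1)" using n by simp
    also have "\<dots> = K * real n powr (1/4)" unfolding powr_diff[symmetric] by simp
    finally show ?thesis .
  qed
  with K show ?thesis by blast
qed

text \<open>H_n - 1: the expected level of a uniform node, and the logarithmic derivative of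
  \<open>mean_poly n\<close> at 1.\<close>

definition harm_mean :: "nat \<Rightarrow> real" where
  "harm_mean n = (\<Sum>j=1..<n. 1 / real (Suc j))"

lemma harm_mean_Suc: "n \<ge> 1 \<Longrightarrow> harm_mean (Suc n) = harm_mean n + 1 / real (Suc n)"
  by (simp add: harm_mean_def)

lemma harm_mean_nonneg: "harm_mean n \<ge> 0"
  by (simp add: harm_mean_def sum_nonneg)

lemma harm_mean_le_ln: "n \<ge> 1 \<Longrightarrow> harm_mean n \<le> ln (real n)"
proof (induction n rule: nat_induct_at_least)
  case base
  show ?case by (simp add: harm_mean_def)
next
  case (Suc n)
  have "ln (real n / real (Suc n)) \<le> real n / real (Suc n) - 1"
    using Suc.hyps by (intro ln_le_minus_one) auto
  also have "\<dots> = - (1 / real (Suc n))" by (simp add: field_simps)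
  finally have "1 / real (Suc n) \<le> ln (real (Suc n)) - ln (real n)"
    using Suc.hyps by (simp add: ln_div)
  thus ?case using Suc by (simp add: harm_mean_Suc)
qed

lemma harm_mean_power:
  "\<exists>K>0. \<forall>n\<ge>1. harm_mean (Suc n) ^ q \<le> K * real n powr (1/4)"
proof -
  \<comment> \<open>Chosen so that a q <= 1/4.\<close>
  define a where "a = 1 / (4 * (real q + 1))"
  have a: "a > 0" by (simp add: a_def)
  have "harm_mean (Suc n) ^ q \<le> (2 powr (1/4) / a ^ q) * real n powr (1/4)" if n: "n \<ge> 1" for n
  proof -
    have "harm_mean (Suc n) \<le> real (Suc n) powr a / a"
      using harm_mean_le_ln[of "Suc n"] ln_powr_bound[of "real (Suc n)" a] a by linarith
    hence "harm_mean (Suc n) ^ q \<le> (real (Suc n) powr a / a) ^ q"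
      using harm_mean_nonneg by (intro power_mono) auto
    also have "\<dots> = real (Suc n) powr (a * q) / a ^ q"
      unfolding power_divide by (subst powr_power) (auto simp: mult.commute)
    also have "\<dots> \<le> (2 * real n) powr (1/4) / a ^ q"
    proof (intro divide_right_mono)
      have "real (Suc n) powr (a * q) \<le> real (Suc n) powr (1/4)"
        by (intro powr_mono) (auto simp: a_def field_simps)
      also have "\<dots> \<le> (2 * real n) powr (1/4)" using n by (intro powr_mono2) auto
      finally show "real (Suc n) powr (a * q) \<le> (2 * real n) powr (1/4)" .
    qed (use a in simp)
    finally show ?thesis by (simp add: powr_mult)
  qed
  thus ?thesis using a by (intro exI[of _ "2 powr (1/4) / a ^ q"]) auto
qed

text \<open>Convexity: the graph lies above its tangent at a. All three Jensen inequalities, for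
  \<open>avg\<close>, \<open>mean\<close> and integrals, are averages of this one.\<close>

lemma power_ge_tangent:
  fixes t a :: real
  assumes "t \<ge> 0" "a \<ge> 0"
  shows "a ^ Suc q + real (Suc q) * a ^ q * (t - a) \<le> t ^ Suc q"
proof (induction q)
  case (Suc q)
  have "t * (a ^ Suc q + real (Suc q) * a ^ q * (t - a)) \<le> t * t ^ Suc q"
    using Suc assms by (intro mult_left_mono) auto
  moreover have "t * (a ^ Suc q + real (Suc q) * a ^ q * (t - a))
     = a ^ Suc (Suc q) + real (Suc (Suc q)) * a ^ Suc q * (t - a) + real (Suc q) * a ^ q * (t - a)\<^sup>2"
    by (simp add: algebra_simps power2_eq_square)
  moreover have "real (Suc q) * a ^ q * (t - a)\<^sup>2 \<ge> 0"
    using assms by (intro mult_nonneg_nonneg) auto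
  ultimately show ?case by simp
qed simp

lemma avg_power_le:
  assumes "n \<ge> 1" "\<And>u. u \<in> {1..n} \<Longrightarrow> g u \<ge> 0"
  shows "avg n g ^ Suc q \<le> avg n (\<lambda>u. g u ^ Suc q)"
proof -
  let ?a = "avg n g" let ?c = "real (Suc q) * ?a ^ q"
  have "avg n (\<lambda>u. ?a ^ Suc q + ?c * (g u + - ?a)) \<le> avg n (\<lambda>u. g u ^ Suc q)"
  proof (rule avg_mono)
    fix u assume u: "u \<in> {1..n}"
    show "?a ^ Suc q + ?c * (g u + - ?a) \<le> g u ^ Suc q"
      using power_ge_tangent[of "g u" ?a q] assms(2)[OF u] avg_nonneg[OF assms(2)] by simp
  qed
  thus ?thesis unfolding avg_add avg_cmult avg_const[OF assms(1)] by simp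
qed

section \<open>The martingale remainder\<close>

lemma one_minus_cos_ge:
  assumes "\<bar>t\<bar> \<le> pi"
  shows "t\<^sup>2 / 12 \<le> 1 - cos t"
proof -
  obtain s where s: "cos t = (\<Sum>m<4. cos_coeff m * t ^ m) + (cos (s + 1/2 * real 4 * pi) / fact 4) * t ^ 4"
    using Maclaurin_cos_expansion[of t 4] by blast
  have "(\<Sum>m<4. cos_coeff m * t ^ m) = 1 - t\<^sup>2 / 2"
    by (simp add: cos_coeff_def lessThan_nat_numeral)
  moreover have "(cos (s + 1/2 * real 4 * pi) / fact 4) * t ^ 4 \<le> t ^ 4 / 24"
    using mult_right_mono[of "cos (s + 1/2 * real 4 * pi)" 1 "t ^ 4"]
    by (simp add: fact_numeral)
  ultimately have cos: "cos t \<le> 1 - t\<^sup>2 / 2 + t ^ 4 / 24" using s by linarith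
  have "t\<^sup>2 \<le> 3.15\<^sup>2"
    using assms pi_approx(2) by (intro abs_le_square_iff[THEN iffD1]) auto
  hence "t\<^sup>2 * t\<^sup>2 \<le> t\<^sup>2 * 10" by (intro mult_left_mono) (auto simp: power2_eq_square)
  moreover have "t ^ 4 = t\<^sup>2 * t\<^sup>2" by (simp add: eval_nat_numeral)
  \<comment> \<open>The constant is 1/2 - 10/24 = 1/12, where 10 bounds pi^2.\<close>
  ultimately show ?thesis using cos by linarith
qed

text \<open>Where 48 comes from: |1 + e^(it)/n|^2 = (1 + 1/n)^2 - (2/n)(1 - cos t), and 1 - cos t >=
  t^2/12 together with (1 + 1/n)^2 <= 4 bounds it by (1 + 1/n)^2 (1 - t^2/(24 n)). The square root
  doubles 24.\<close>

definition decay_exponent :: "real \<Rightarrow> real" where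
  "decay_exponent t = 1 - t\<^sup>2 / 48"

lemma decay_exponent_ge: "\<bar>t\<bar> \<le> pi \<Longrightarrow> decay_exponent t \<ge> 3/4"
proof -
  assume "\<bar>t\<bar> \<le> pi"
  hence "t\<^sup>2 \<le> 3.15\<^sup>2"
    using pi_approx(2) by (intro abs_le_square_iff[THEN iffD1]) auto
  thus ?thesis by (simp add: decay_exponent_def power2_eq_square)
qed

lemma norm_one_plus_cis_le:
  assumes "n \<ge> 1" "\<bar>t\<bar> \<le> pi"
  shows "cmod (1 + cis t / of_nat n) \<le> (real (Suc n) / real n) powr decay_exponent t"
proof -
  define y where "y = 1 / real n"
  have y: "0 < y" "y \<le> 1" using assms(1) by (auto simp: y_def)
  have ratio: "real (Suc n) / real n = 1 + y" using assms(1) by (simp add: y_def field_simps)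
  have "(cmod (1 + cis t / of_nat n))\<^sup>2 = (1 + y)\<^sup>2 - 2 * y * (1 - cos t)"
  proof -
    have "1 + cis t / of_nat n = Complex (1 + y * cos t) (y * sin t)"
      by (simp add: complex_eq_iff y_def Re_divide_of_nat Im_divide_of_nat)
    hence "(cmod (1 + cis t / of_nat n))\<^sup>2 = (1 + y * cos t)\<^sup>2 + (y * sin t)\<^sup>2"
      by (simp add: cmod_power2)
    also have "\<dots> = 1 + 2 * y * cos t + y\<^sup>2 * ((sin t)\<^sup>2 + (cos t)\<^sup>2)"
    proof -
      have "(1 + y * c)\<^sup>2 + (y * s)\<^sup>2 = 1 + 2 * y * c + y\<^sup>2 * (s\<^sup>2 + c\<^sup>2)" for c s :: real
        by (simp add: power2_eq_square algebra_simps)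
      thus ?thesis .
    qed
    finally show ?thesis by (simp add: power2_sum algebra_simps)
  qed
  also have "\<dots> \<le> (1 + y)\<^sup>2 - 2 * y * (t\<^sup>2 / 12)"
    using one_minus_cos_ge[OF assms(2)] y by (intro diff_left_mono mult_left_mono) auto
  also have "\<dots> \<le> (1 + y)\<^sup>2 * (1 + - (y * t\<^sup>2 / 24))"
  proof -
    have "(1 + y)\<^sup>2 * (y * t\<^sup>2 / 24) \<le> 4 * (y * t\<^sup>2 / 24)"
      using y power_mono[of "1 + y" 2 2] by (intro mult_right_mono) auto
    thus ?thesis by (simp add: algebra_simps)
  qed
  also have "\<dots> \<le> (1 + y)\<^sup>2 * exp (- (y * t\<^sup>2 / 24))"
    by (intro mult_left_mono exp_ge_add_one_self) auto
  \<comment> \<open>Since ln (1 + y) <= y, the exponential becomes a power of 1 + y = (n + 1)/n, and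
    products over n telescope.\<close>
  also have "\<dots> \<le> (1 + y)\<^sup>2 * exp (- (ln (1 + y) * t\<^sup>2 / 24))"
    using ln_add_one_self_le_self[of y] y
    by (intro mult_left_mono) (auto intro!: mult_right_mono)
  also have "\<dots> = ((1 + y) powr decay_exponent t)\<^sup>2"
  proof -
    have "(1 + y)\<^sup>2 = exp (2 * ln (1 + y))" using y by (simp add: exp_double)
    moreover have "((1 + y) powr decay_exponent t)\<^sup>2 = exp (2 * (decay_exponent t * ln (1 + y)))"
      using y unfolding powr_def by (simp only: exp_double) simp
    moreover have "2 * ln (1 + y) + - (ln (1 + y) * t\<^sup>2 / 24) = 2 * (decay_exponent t * ln (1 + y))"
      by (simp add: decay_exponent_def algebra_simps)
    ultimately show ?thesis by (simp only: exp_add[symmetric])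
  qed
  finally show ?thesis unfolding ratio by (rule power2_le_imp_le) simp
qed

lemma norm_mean_poly_cis_le:
  assumes "\<bar>t\<bar> \<le> pi"
  shows "n \<ge> 1 \<Longrightarrow> cmod (mean_poly n (cis t)) \<le> real n powr decay_exponent t"
proof (induction n rule: nat_induct_at_least)
  case base
  show ?case by (simp add: mean_poly_def)
next
  case (Suc n)
  have "cmod (mean_poly (Suc n) (cis t)) = cmod (1 + cis t / of_nat n) * cmod (mean_poly n (cis t))"
    by (simp add: mean_poly_Suc[OF Suc.hyps] norm_mult)
  also have "\<dots> \<le> (real (Suc n) / real n) powr decay_exponent t * real n powr decay_exponent t"
    by (intro mult_mono norm_one_plus_cis_le Suc assms) auto
  also have "\<dots> = real (Suc n) powr decay_exponent t"
    using Suc.hyps by (simp flip: powr_mult)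
  finally show ?case .
qed

text \<open>From k to k + 1 the error changes by (z^k - 1)(z - 1), which is at most k |z - 1|^2 on
  the unit circle.\<close>

lemma norm_power_minus_linear_le:
  fixes z :: complex
  assumes "cmod z = 1"
  shows "cmod (z ^ k - 1 - of_nat k * (z - 1)) \<le> (real k)\<^sup>2 * (cmod (z - 1))\<^sup>2"
proof (induction k)
  case (Suc k)
  have "z ^ Suc k - 1 - of_nat (Suc k) * (z - 1)
      = (z ^ k - 1 - of_nat k * (z - 1)) + (z ^ k - 1 ^ k) * (z - 1)"
    by (simp add: algebra_simps)
  also have "cmod \<dots> \<le> (real k)\<^sup>2 * (cmod (z - 1))\<^sup>2 + (real k * cmod (z - 1)) * cmod (z - 1)"
  proof (rule norm_triangle_mono[OF Suc])
    show "cmod ((z ^ k - 1 ^ k) * (z - 1)) \<le> (real k * cmod (z - 1)) * cmod (z - 1)"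
      unfolding norm_mult using assms by (intro mult_right_mono norm_power_diff) auto
  qed
  also have "\<dots> = ((real k)\<^sup>2 + real k) * (cmod (z - 1))\<^sup>2"
    by (simp add: algebra_simps power2_eq_square)
  also have "\<dots> \<le> (real (Suc k))\<^sup>2 * (cmod (z - 1))\<^sup>2"
    by (intro mult_right_mono) (auto simp: power2_eq_square algebra_simps)
  finally show ?case .
qed simp

text \<open>P(z)/n is the product of the factors (j + z)/(j + 1). They lie in the closed unit disc,
  so their distances |z - 1|/(j + 1) from 1 simply add up.\<close>

lemma norm_normalized_mean_poly_le:
  fixes z :: complex
  assumes "cmod z = 1"
  shows "n \<ge> 1 \<Longrightarrow> cmod (mean_poly n z / of_nat n - 1) \<le> cmod (z - 1) * harm_mean n"
proof (induction n rule: nat_induct_at_least)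
  case base
  show ?case by (simp add: mean_poly_def harm_mean_def)
next
  case (Suc n)
  define r where "r = mean_poly n z / of_nat n"
  define q where "q = (of_nat n + z) / of_nat (Suc n)"
  have n: "(of_nat n :: complex) \<noteq> 0" "(of_nat (Suc n) :: complex) \<noteq> 0"
    using Suc.hyps by (simp, simp only: of_nat_eq_0_iff)
  have eq: "mean_poly (Suc n) z / of_nat (Suc n) - 1 = (r - 1) * q + (z - 1) / of_nat (Suc n)"
  proof -
    have "mean_poly (Suc n) z / of_nat (Suc n) = r * q"
      unfolding mean_poly_Suc[OF Suc.hyps] r_def q_def using n by (simp add: field_simps)
    moreover have "q = 1 + (z - 1) / of_nat (Suc n)"
      unfolding q_def using n(2) by (simp add: field_simps)
    moreover have "r * q - 1 = (r - 1) * q + (q - 1)" by (simp add: algebra_simps)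
    ultimately show ?thesis by simp
  qed
  have "cmod q \<le> 1"
  proof -
    have "cmod (of_nat n + z) \<le> real (Suc n)"
      using norm_triangle_ineq[of "of_nat n" z] assms by simp
    moreover have "cmod q = cmod (of_nat n + z) / real (Suc n)"
      by (simp only: q_def norm_divide norm_of_nat)
    ultimately show ?thesis by simp
  qed
  hence "cmod ((r - 1) * q) \<le> cmod (r - 1)"
    by (simp add: norm_mult mult_left_le)
  hence "cmod ((r - 1) * q + (z - 1) / of_nat (Suc n))
      \<le> cmod (z - 1) * harm_mean n + cmod (z - 1) / real (Suc n)"
    using Suc.IH unfolding r_def
    by (intro norm_triangle_mono) (auto simp: norm_divide simp del: of_nat_Suc)
  thus ?case unfolding eq harm_mean_Suc[OF Suc.hyps] by (simp add: algebra_simps)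
qed

section \<open>Recursion and moments of the remainder\<close>

abbreviation mean_level :: "nat \<Rightarrow> (nat \<times> nat) set \<Rightarrow> real" where
  "mean_level n E \<equiv> avg n (\<lambda>v. real (level E v))"

definition depth_dev :: "nat \<Rightarrow> (nat \<times> nat) set \<Rightarrow> real" where
  "depth_dev n E = mean_level n E - harm_mean n"

definition remainder :: "nat \<Rightarrow> (nat \<times> nat) set \<Rightarrow> complex \<Rightarrow> complex" where
  "remainder n E z =
     level_poly n E z - mean_poly n z - (z - 1) * of_real (depth_dev n E) * mean_poly n z"

text \<open>The centred part of one growth step: the new monomial minus its average over the
  parents, minus the matching step of the linear term. As P_(n+1)(z)/(n+1) is 1 at z = 1, the
  first-order terms in z - 1 cancel.\<close>

definition increment :: "nat \<Rightarrow> (nat \<times> nat) set \<Rightarrow> complex \<Rightarrow> nat \<Rightarrow> complex" where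
  "increment n E z u = z ^ Suc (level E u) - z * level_poly n E z / of_nat n
     - (z - 1) * of_real (real (level E u) - mean_level n E) * (mean_poly (Suc n) z / of_nat (Suc n))"

lemma depth_dev_1: "depth_dev 1 E = 0"
  by (simp add: depth_dev_def avg_def harm_mean_def level_root[simplified])

lemma remainder_1: "remainder 1 E z = 0"
  by (simp add: remainder_def depth_dev_1[simplified] level_poly_def mean_poly_def level_root[simplified])

text \<open>The extra 1 in the level of the new node is absorbed by the step of
  \<open>harm_mean\<close>. What remains sums to 0 over the parents, so \<open>depth_dev\<close> is
  a martingale.\<close>

lemma depth_dev_insert:
  assumes "n \<ge> 1" "E \<in> recursive_trees n" "u \<in> {1..n}"
  shows "depth_dev (Suc n) (insert (u, Suc n) E)
       = depth_dev n E + (real (level E u) - mean_level n E) / real (Suc n)"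
proof -
  define q where "q = mean_level n E"
  define l where "l = real (level E u)"
  have "(\<Sum>v=1..n. real (level E v)) = q * real n"
    using assms(1) by (simp add: q_def avg_def)
  hence "mean_level (Suc n) (insert (u, Suc n) E) = (q * real n + (1 + l)) / (real n + 1)"
    unfolding avg_def sum_level_insert[OF assms(2,3)] by (simp add: l_def add.commute)
  moreover have "(q * x + (1 + l)) / (x + 1) - (h + 1 / (x + 1)) = q - h + (l - q) / (x + 1)"
    if "x > 0" for x h :: real
  proof -
    have "q * x + (1 + l) = 1 + q * (x + 1) + (l - q)" by (simp add: algebra_simps)
    hence "(q * x + (1 + l)) / (x + 1) = 1 / (x + 1) + q * (x + 1) / (x + 1) + (l - q) / (x + 1)"
      by (simp only: add_divide_distrib)
    thus ?thesis using that by simp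
  qed
  moreover have "real (Suc n) = real n + 1" "real n > 0" using assms(1) by simp_all
  ultimately show ?thesis
    unfolding depth_dev_def harm_mean_Suc[OF assms(1)] q_def[symmetric] l_def[symmetric]
    by (simp only:)
qed

lemma remainder_insert:
  assumes "n \<ge> 1" "E \<in> recursive_trees n" "u \<in> {1..n}"
  shows "remainder (Suc n) (insert (u, Suc n) E) z
       = (1 + z / of_nat n) * remainder n E z + increment n E z u"
proof -
  define w where "w = 1 + z / of_nat n"
  have "z * level_poly n E z / of_nat n = (w - 1) * level_poly n E z"
    by (simp add: w_def)
  thus ?thesis
    unfolding remainder_def increment_def level_poly_insert[OF assms(2,3)] depth_dev_insert[OF assms]
      mean_poly_Suc[OF assms(1)] w_def[symmetric]
    by (simp add: algebra_simps add_divide_distrib diff_divide_distrib)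
qed

lemma sum_level_deviation:
  assumes "n \<ge> 1"
  shows "(\<Sum>u=1..n. real (level E u) - mean_level n E) = 0"
  using assms by (simp add: sum_subtractf avg_def)

lemma sum_increment:
  assumes "n \<ge> 1"
  shows "(\<Sum>u=1..n. increment n E z u) = 0"
proof -
  have "(\<Sum>u=1..n. (z - 1) * of_real (real (level E u) - mean_level n E) * c) = 0" for c
  proof -
    have "(\<Sum>u=1..n. (z - 1) * of_real (real (level E u) - mean_level n E) * c)
        = (z - 1) * of_real (\<Sum>u=1..n. real (level E u) - mean_level n E) * c"
      unfolding of_real_sum sum_distrib_left sum_distrib_right ..
    thus ?thesis unfolding sum_level_deviation[OF assms] by simp
  qed
  moreover have "(\<Sum>u=1..n. z ^ Suc (level E u)) = z * level_poly n E z"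
    by (simp add: level_poly_def sum_distrib_left)
  ultimately show ?thesis
    using assms unfolding increment_def sum_subtractf by (simp only: sum_constant) simp
qed

definition level_sq :: "(nat \<times> nat) set \<Rightarrow> nat \<Rightarrow> real" where
  "level_sq E u = (1 + real (level E u))\<^sup>2"

text \<open>A majorant free of z, both for |increment| / |z - 1|^2 and for the deviation of a level
  from the mean level.\<close>

definition level_weight :: "nat \<Rightarrow> (nat \<times> nat) set \<Rightarrow> nat \<Rightarrow> real" where
  "level_weight n E u = 3 * (level_sq E u + avg n (level_sq E)) + (harm_mean (Suc n))\<^sup>2"

lemma level_sq_nonneg: "0 \<le> level_sq E u" "0 \<le> avg n (level_sq E)"
  by (auto simp: level_sq_def intro!: avg_nonneg)

lemma level_deviation_bounds:
  assumes "n \<ge> 1"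
  shows "\<bar>real (level E u) - mean_level n E\<bar> \<le> level_sq E u + avg n (level_sq E)"
    and "(real (level E u) - mean_level n E)\<^sup>2 \<le> 2 * (level_sq E u + avg n (level_sq E))"
proof -
  have l: "real (level E v) \<le> level_sq E v" "(real (level E v))\<^sup>2 \<le> level_sq E v" for v
    by (simp_all add: level_sq_def power2_eq_square algebra_simps)
  define m where "m = mean_level n E"
  define x where "x = real (level E u)"
  have m0: "0 \<le> m" unfolding m_def by (rule avg_nonneg) simp
  have m1: "m \<le> avg n (level_sq E)" unfolding m_def by (intro avg_mono l)
  have m2: "m\<^sup>2 \<le> avg n (level_sq E)"
  proof -
    have "m\<^sup>2 \<le> avg n (\<lambda>v. (real (level E v))\<^sup>2)"
      using avg_power_le[OF assms(1), of "\<lambda>v. real (level E v)" 1] by (simp add: m_def numeral_2_eq_2)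
    also have "\<dots> \<le> avg n (level_sq E)" by (intro avg_mono l)
    finally show ?thesis .
  qed
  have "x \<ge> 0" "x \<le> level_sq E u" "x\<^sup>2 \<le> level_sq E u" using l by (simp_all add: x_def)
  moreover have "(x - m)\<^sup>2 \<le> 2 * x\<^sup>2 + 2 * m\<^sup>2"
    using zero_le_power2[of "x + m"] by (simp add: power2_eq_square algebra_simps)
  ultimately have "\<bar>x - m\<bar> \<le> level_sq E u + avg n (level_sq E)"
    and "2 * x\<^sup>2 + 2 * m\<^sup>2 \<le> 2 * (level_sq E u + avg n (level_sq E))"
    and sq: "(x - m)\<^sup>2 \<le> 2 * x\<^sup>2 + 2 * m\<^sup>2"
    using m0 m1 m2 unfolding distrib_left by linarith+
  moreover from order_trans[OF sq this(2)]
  have "(x - m)\<^sup>2 \<le> 2 * (level_sq E u + avg n (level_sq E))" .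
  ultimately have "\<bar>x - m\<bar> \<le> level_sq E u + avg n (level_sq E)"
    "(x - m)\<^sup>2 \<le> 2 * (level_sq E u + avg n (level_sq E))" by blast+
  thus "\<bar>real (level E u) - mean_level n E\<bar> \<le> level_sq E u + avg n (level_sq E)"
    "(real (level E u) - mean_level n E)\<^sup>2 \<le> 2 * (level_sq E u + avg n (level_sq E))"
    unfolding x_def m_def .
qed

lemma level_deviation_le_weight:
  assumes "n \<ge> 1"
  shows "\<bar>real (level E u) - mean_level n E\<bar> \<le> level_weight n E u"
proof -
  have "0 \<le> (harm_mean (Suc n))\<^sup>2" by simp
  thus ?thesis
    using level_deviation_bounds(1)[OF assms, of E u] level_sq_nonneg(1)[of E u] level_sq_nonneg(2)[of n E]
    unfolding level_weight_def distrib_left by linarith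
qed

lemma norm_avg_le:
  fixes f :: "nat \<Rightarrow> complex"
  shows "cmod ((\<Sum>v=1..n. f v) / of_nat n) \<le> avg n (\<lambda>v. cmod (f v))"
  unfolding avg_def norm_divide norm_of_nat by (intro divide_right_mono norm_sum) auto

text \<open>Linearised monomials have errors \<open>e\<close> quadratic in z - 1. The linear terms
  cancel up to (z - 1) d (1 - r), and 1 - r is again at most |z - 1| times
  \<open>harm_mean\<close>.\<close>

lemma norm_increment_le:
  assumes "n \<ge> 1" "cmod z = 1"
  shows "cmod (increment n E z u) \<le> (cmod (z - 1))\<^sup>2 * level_weight n E u"
proof -
  define e where "e v = z ^ Suc (level E v) - 1 - of_nat (Suc (level E v)) * (z - 1)" for v
  define r where "r = mean_poly (Suc n) z / of_nat (Suc n)"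
  define d where "d = real (level E u) - mean_level n E"
  define h where "h = harm_mean (Suc n)"
  define q where "q = level_sq E"
  define c where "c = (cmod (z - 1))\<^sup>2"
  have n: "(of_nat n :: complex) \<noteq> 0" using assms(1) by simp
  have e: "cmod (e v) \<le> c * q v" for v
    using norm_power_minus_linear_le[OF assms(2), of "Suc (level E v)"]
    by (simp add: e_def q_def level_sq_def c_def mult.commute)
  have r: "cmod (1 - r) \<le> cmod (z - 1) * h"
    using norm_normalized_mean_poly_le[OF assms(2), of "Suc n"]
    unfolding r_def h_def by (subst norm_minus_commute) simp
  have split: "increment n E z u = e u - (\<Sum>v=1..n. e v) / of_nat n + (z - 1) * of_real d * (1 - r)"
  proof -
    have "(\<Sum>v=1..n. e v) = z * level_poly n E z - of_nat n - (of_nat n + (\<Sum>v=1..n. of_nat (level E v))) * (z - 1)"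
    proof -
      have "(\<Sum>v=1..n. e v) = (\<Sum>v=1..n. z * z ^ level E v) - (\<Sum>v=1..n. 1)
          - (\<Sum>v=1..n. 1 + of_nat (level E v)) * (z - 1)"
        unfolding e_def sum_subtractf sum_distrib_right by simp
      thus ?thesis by (simp add: sum.distrib level_poly_def sum_distrib_left)
    qed
    also have "(\<Sum>v=1..n. of_nat (level E v)) = of_nat n * complex_of_real (mean_level n E)"
      using assms(1) by (simp add: avg_def)
    finally have "(\<Sum>v=1..n. e v) / of_nat n = z * level_poly n E z / of_nat n - 1 - (1 + of_real (mean_level n E)) * (z - 1)"
      using n by (simp add: field_simps)
    thus ?thesis
      unfolding increment_def e_def d_def r_def[symmetric] by (simp add: algebra_simps)
  qed
  have "cmod (increment n E z u) \<le> c * q u + avg n (\<lambda>v. c * q v) + c * (\<bar>d\<bar> * h)"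
    unfolding split
  proof (rule norm_triangle_mono)
    have "cmod (e u - (\<Sum>v=1..n. e v) / of_nat n) \<le> cmod (e u) + cmod ((\<Sum>v=1..n. e v) / of_nat n)"
      by (rule norm_triangle_ineq4)
    also have "\<dots> \<le> c * q u + avg n (\<lambda>v. c * q v)"
      by (intro add_mono e order_trans[OF norm_avg_le] avg_mono)
    finally show "cmod (e u - (\<Sum>v=1..n. e v) / of_nat n) \<le> c * q u + avg n (\<lambda>v. c * q v)" .
    have "cmod ((z - 1) * of_real d * (1 - r)) = cmod (z - 1) * \<bar>d\<bar> * cmod (1 - r)"
      by (simp add: norm_mult)
    also have "\<dots> \<le> cmod (z - 1) * \<bar>d\<bar> * (cmod (z - 1) * h)"
      by (intro mult_left_mono r) auto
    finally show "cmod ((z - 1) * of_real d * (1 - r)) \<le> c * (\<bar>d\<bar> * h)"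
      by (simp add: c_def power2_eq_square mult_ac)
  qed
  also have "\<dots> = c * (q u + avg n q + \<bar>d\<bar> * h)"
    by (simp add: avg_cmult algebra_simps)
  also have "\<dots> \<le> c * level_weight n E u"
  proof (rule mult_left_mono)
    \<comment> \<open>The product of deviation and \<open>harm_mean\<close> is split into squares,
      which the weight contains.\<close>
    have "2 * (\<bar>d\<bar> * h) \<le> d\<^sup>2 + h\<^sup>2"
      using sum_squares_bound[of "\<bar>d\<bar>" h] by simp
    moreover have "d\<^sup>2 \<le> 2 * (q u + avg n q)"
      using level_deviation_bounds(2)[OF assms(1), of E u] unfolding d_def q_def .
    moreover have "0 \<le> q u" "0 \<le> avg n q" "0 \<le> h\<^sup>2" by (auto simp: q_def level_sq_nonneg)
    ultimately show "q u + avg n q + \<bar>d\<bar> * h \<le> level_weight n E u"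
      unfolding level_weight_def h_def[symmetric] q_def[symmetric] distrib_left by linarith
  qed (simp add: c_def)
  finally show ?thesis unfolding c_def .
qed

lemma power_sum3_le:
  fixes a b c :: real
  assumes "a \<ge> 0" "b \<ge> 0" "c \<ge> 0"
  shows "(a + b + c) ^ k \<le> 3 ^ k * (a ^ k + b ^ k + c ^ k)"
proof -
  define m where "m = max a (max b c)"
  have "(a + b + c) ^ k \<le> (3 * m) ^ k" using assms by (intro power_mono) (auto simp: m_def)
  also have "\<dots> = 3 ^ k * m ^ k" by (simp add: power_mult_distrib)
  also have "m ^ k \<le> a ^ k + b ^ k + c ^ k"
    using assms by (auto simp: m_def max_def)
  finally show ?thesis by simp
qed

lemma level_weight_nonneg: "0 \<le> level_weight n E u"
  unfolding level_weight_def by (intro add_nonneg_nonneg mult_nonneg_nonneg level_sq_nonneg) auto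

text \<open>Jensen moves the power inside the average of \<open>level_sq\<close>; then
  \<open>level_moment\<close> and \<open>harm_mean_power\<close> each contribute n^(1/4).\<close>

lemma level_weight_moment:
  "\<exists>K>0. \<forall>n\<ge>1. mean n (\<lambda>E. avg n (\<lambda>u. level_weight n E u ^ Suc q)) \<le> K * real n powr (1/4)"
proof -
  define k where "k = Suc q"
  obtain K1 where K1: "K1 > 0"
    "\<And>n. n \<ge> 1 \<Longrightarrow> mean n (\<lambda>E. avg n (\<lambda>u. (1 + real (level E u)) ^ (2 * k))) \<le> K1 * real n powr (1/4)"
    using level_moment[of "2 * k"] by blast
  obtain K2 where K2: "K2 > 0" "\<And>n. n \<ge> 1 \<Longrightarrow> harm_mean (Suc n) ^ (2 * k) \<le> K2 * real n powr (1/4)"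
    using harm_mean_power[of "2 * k"] by blast
  define K where "K = 3 ^ k * (2 * (3 ^ k * K1) + K2)"
  have "mean n (\<lambda>E. avg n (\<lambda>u. level_weight n E u ^ k)) \<le> K * real n powr (1/4)" if n: "n \<ge> 1" for n
  proof -
    define Q where "Q E = avg n (\<lambda>u. (1 + real (level E u)) ^ (2 * k))" for E
    have "avg n (\<lambda>u. level_weight n E u ^ k)
        \<le> 3 ^ k * (2 * (3 ^ k * Q E) + harm_mean (Suc n) ^ (2 * k))" for E
    proof -
      define q where "q = level_sq E"
      have q0: "q v \<ge> 0" for v by (simp add: q_def level_sq_nonneg)
      have Q: "Q E = avg n (\<lambda>v. q v ^ k)" unfolding Q_def q_def level_sq_def power_mult ..
      have aq: "avg n q ^ k \<le> Q E"
        unfolding Q k_def by (rule avg_power_le[OF n q0])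
      have "avg n (\<lambda>u. level_weight n E u ^ k)
          \<le> avg n (\<lambda>u. 3 ^ k * ((3 ^ k * q u ^ k + 3 ^ k * Q E) + harm_mean (Suc n) ^ (2 * k)))"
      proof (rule avg_mono)
        fix u
        have "level_weight n E u ^ k = (3 * q u + 3 * avg n q + (harm_mean (Suc n))\<^sup>2) ^ k"
          by (simp add: level_weight_def q_def algebra_simps)
        also have "\<dots> \<le> 3 ^ k * ((3 * q u) ^ k + (3 * avg n q) ^ k + ((harm_mean (Suc n))\<^sup>2) ^ k)"
          using q0 avg_nonneg[of n q] by (intro power_sum3_le) auto
        also have "\<dots> = 3 ^ k * ((3 ^ k * q u ^ k + 3 ^ k * avg n q ^ k) + harm_mean (Suc n) ^ (2 * k))"
          by (simp add: power_mult_distrib power_mult)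
        also have "\<dots> \<le> 3 ^ k * ((3 ^ k * q u ^ k + 3 ^ k * Q E) + harm_mean (Suc n) ^ (2 * k))"
          using aq by (intro mult_left_mono add_mono) auto
        finally show "level_weight n E u ^ k \<le> \<dots>" .
      qed
      also have "\<dots> = 3 ^ k * (2 * (3 ^ k * Q E) + harm_mean (Suc n) ^ (2 * k))"
        unfolding avg_add avg_cmult avg_const[OF n] Q[symmetric] by simp
      finally show ?thesis .
    qed
    hence "mean n (\<lambda>E. avg n (\<lambda>u. level_weight n E u ^ k))
        \<le> mean n (\<lambda>E. 3 ^ k * (2 * (3 ^ k * Q E) + harm_mean (Suc n) ^ (2 * k)))"
      by (intro mean_mono)
    also have "\<dots> = 3 ^ k * (2 * (3 ^ k * mean n Q) + harm_mean (Suc n) ^ (2 * k))"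
      unfolding mean_add mean_cmult mean_const[OF n] ..
    also have "\<dots> \<le> 3 ^ k * (2 * (3 ^ k * (K1 * real n powr (1/4))) + K2 * real n powr (1/4))"
      using K1(2)[OF n] K2(2)[OF n] unfolding Q_def[symmetric]
      by (intro mult_left_mono add_mono) auto
    also have "\<dots> = K * real n powr (1/4)" by (simp add: K_def algebra_simps)
    finally show ?thesis .
  qed
  moreover have "K > 0" using K1 K2 by (simp add: K_def add_pos_pos)
  ultimately show ?thesis unfolding k_def by blast
qed

lemma norm_cis_minus_one_le: "cmod (cis t - 1) \<le> \<bar>t\<bar>"
proof -
  have "cmod (cis t - 1) = 2 * \<bar>sin (t / 2)\<bar>"
    using dist_exp_i_1[of t] by (simp add: cis_conv_exp)
  also have "\<dots> \<le> 2 * \<bar>t / 2\<bar>" by (intro mult_left_mono abs_sin_x_le_abs_x) auto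
  finally show ?thesis by simp
qed

lemma mean_poly_1: "n \<ge> 1 \<Longrightarrow> mean_poly n 1 = of_nat n"
proof (induction n rule: nat_induct_at_least)
  case (Suc n)
  thus ?case by (simp add: mean_poly_Suc field_simps)
qed (simp add: mean_poly_def)

text \<open>This is \<open>moment_recursion\<close> with a n = 1 + z/n and beta =
  \<open>decay_exponent t\<close>. Apart from beta, t enters only through the factor t^4 of G, so K
  is uniform in t.\<close>

lemma remainder_moment:
  "\<exists>K>0. \<forall>n\<ge>1. \<forall>t. \<bar>t\<bar> \<le> pi \<longrightarrow>
     mean n (\<lambda>E. cmod (remainder n E (cis t)) ^ (2 * Suc p))
       \<le> (K * (t\<^sup>2 * real n powr decay_exponent t)) ^ (2 * Suc p)"
proof -
  obtain C where C: "C > 0" and rec: "\<And>(X :: nat \<Rightarrow> (nat \<times> nat) set \<Rightarrow> complex) a d G \<beta> n.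
     G > 0 \<Longrightarrow> (\<And>E. X 1 E = 0) \<Longrightarrow>
     (\<And>n E u. n \<ge> 1 \<Longrightarrow> E \<in> recursive_trees n \<Longrightarrow> u \<in> {1..n} \<Longrightarrow>
        X (Suc n) (insert (u, Suc n) E) = a n * X n E + d n E u) \<Longrightarrow>
     (\<And>n E. n \<ge> 1 \<Longrightarrow> E \<in> recursive_trees n \<Longrightarrow> (\<Sum>u=1..n. d n E u) = 0) \<Longrightarrow>
     (\<And>n. n \<ge> 1 \<Longrightarrow> cmod (a n) \<le> (real (Suc n) / real n) powr \<beta>) \<Longrightarrow>
     (\<And>n. n \<ge> 1 \<Longrightarrow> mean n (\<lambda>E. avg n (\<lambda>u. cmod (d n E u) ^ (2 * Suc p)))
         \<le> (G * real (Suc n) powr (2 * \<beta>) * real n powr (-5/4)) ^ Suc p) \<Longrightarrow>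
     n \<ge> 1 \<Longrightarrow> mean n (\<lambda>E. cmod (X n E) ^ (2 * Suc p)) \<le> (C * G * real n powr (2 * \<beta>)) ^ Suc p"
    by (fact moment_recursion[of p])
  obtain K0 where K0: "K0 > 0" "\<And>n. n \<ge> 1 \<Longrightarrow>
      mean n (\<lambda>E. avg n (\<lambda>u. level_weight n E u ^ (2 * Suc p))) \<le> K0 * real n powr (1/4)"
    using level_weight_moment[of "2 * p + 1"] by auto
  \<comment> \<open>The recursion bounds the square of the norm, hence the root.\<close>
  define K where "K = sqrt (C * (K0 + 1))"
  have "mean n (\<lambda>E. cmod (remainder n E (cis t)) ^ (2 * Suc p))
       \<le> (K * (t\<^sup>2 * real n powr decay_exponent t)) ^ (2 * Suc p)"
    if n: "n \<ge> 1" and t: "\<bar>t\<bar> \<le> pi" for n t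
  proof (cases "t = 0")
    \<comment> \<open>G has to be positive, so t = 0 is separate; there the remainder
      vanishes.\<close>
    case True
    have "remainder n E 1 = 0" for E
      by (simp add: remainder_def level_poly_def mean_poly_1[OF n])
    thus ?thesis using True by (simp add: mean_def)
  next
    case False
    define G where "G = (K0 + 1) * t ^ 4"
    have G: "G > 0" using K0 False by (simp add: G_def)
    have "mean n (\<lambda>E. cmod (remainder n E (cis t)) ^ (2 * Suc p))
        \<le> (C * G * real n powr (2 * decay_exponent t)) ^ Suc p"
    proof (rule rec[where X = "\<lambda>n E. remainder n E (cis t)" and a = "\<lambda>n. 1 + cis t / of_nat n"
          and d = "\<lambda>n E. increment n E (cis t)", OF G remainder_1 remainder_insert sum_increment
          norm_one_plus_cis_le[OF _ t] _ n])
      fix n :: nat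
      assume n: "n \<ge> 1"
      have "mean n (\<lambda>E. avg n (\<lambda>u. cmod (increment n E (cis t) u) ^ (2 * Suc p)))
          \<le> mean n (\<lambda>E. avg n (\<lambda>u. (t\<^sup>2) ^ (2 * Suc p) * level_weight n E u ^ (2 * Suc p)))"
      proof (intro mean_mono avg_mono)
        fix E u
        have "cmod (increment n E (cis t) u) \<le> (cmod (cis t - 1))\<^sup>2 * level_weight n E u"
          by (rule norm_increment_le[OF n norm_cis])
        also have "\<dots> \<le> \<bar>t\<bar>\<^sup>2 * level_weight n E u"
          by (intro mult_right_mono power_mono norm_cis_minus_one_le level_weight_nonneg) auto
        finally have "cmod (increment n E (cis t) u) ^ (2 * Suc p) \<le> (t\<^sup>2 * level_weight n E u) ^ (2 * Suc p)"
          by (intro power_mono) auto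
        thus "cmod (increment n E (cis t) u) ^ (2 * Suc p)
            \<le> (t\<^sup>2) ^ (2 * Suc p) * level_weight n E u ^ (2 * Suc p)"
          by (simp only: power_mult_distrib)
      qed
      also have "\<dots> \<le> (t\<^sup>2) ^ (2 * Suc p) * (K0 * real n powr (1/4))"
        unfolding avg_cmult mean_cmult by (intro mult_left_mono K0 n) auto
      also have "\<dots> \<le> (t\<^sup>2) ^ (2 * Suc p) * ((K0 + 1) * real n powr (1/4)) ^ Suc p"
      proof (rule mult_left_mono)
        \<comment> \<open>A base of at least 1 may be raised to the power p + 1, the shape that the
          recursion asks for; hence K0 + 1.\<close>
        have "1 * 1 \<le> (K0 + 1) * real n powr (1/4)"
          using K0 n by (intro mult_mono ge_one_powr_ge_zero) auto
        hence "(K0 + 1) * real n powr (1/4) \<le> ((K0 + 1) * real n powr (1/4)) ^ Suc p"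
          using K0 by (intro self_le_power) auto
        moreover have "K0 * real n powr (1/4) \<le> (K0 + 1) * real n powr (1/4)"
          by (intro mult_right_mono) auto
        ultimately show "K0 * real n powr (1/4) \<le> ((K0 + 1) * real n powr (1/4)) ^ Suc p" by linarith
      qed auto
      also have "\<dots> = (G * real n powr (1/4)) ^ Suc p"
      proof -
        have "(t\<^sup>2) ^ (2 * Suc p) = (t ^ 4) ^ Suc p"
          by (simp only: power_mult[symmetric] mult.assoc[symmetric]) simp
        thus ?thesis unfolding G_def by (simp only: power_mult_distrib mult_ac)
      qed
      also have "\<dots> \<le> (G * real (Suc n) powr (2 * decay_exponent t) * real n powr (-5/4)) ^ Suc p"
      proof (rule power_mono)
        \<comment> \<open>The exponents fit because twice \<open>decay_exponent t\<close> is at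
          least 3/2, and 3/2 - 5/4 = 1/4.\<close>
        have "real n powr (3/2) \<le> real n powr (2 * decay_exponent t)"
          using n decay_exponent_ge[OF t] by (intro powr_mono) auto
        also have "\<dots> \<le> real (Suc n) powr (2 * decay_exponent t)"
          using decay_exponent_ge[OF t] by (intro powr_mono2) auto
        finally have "real n powr (3/2) * real n powr (-5/4)
            \<le> real (Suc n) powr (2 * decay_exponent t) * real n powr (-5/4)"
          by (intro mult_right_mono) auto
        moreover have "real n powr (3/2) * real n powr (-5/4) = real n powr (1/4)"
          by (simp flip: powr_add)
        ultimately have "real n powr (1/4) \<le> real (Suc n) powr (2 * decay_exponent t) * real n powr (-5/4)"
          by (simp only:)
        thus "G * real n powr (1/4) \<le> G * real (Suc n) powr (2 * decay_exponent t) * real n powr (-5/4)"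
          using G unfolding mult.assoc by (intro mult_left_mono) auto
      qed (use G in auto)
      finally show "mean n (\<lambda>E. avg n (\<lambda>u. cmod (increment n E (cis t) u) ^ (2 * Suc p)))
          \<le> (G * real (Suc n) powr (2 * decay_exponent t) * real n powr (-5/4)) ^ Suc p" .
    qed auto
    also have "C * G * real n powr (2 * decay_exponent t) = (K * (t\<^sup>2 * real n powr decay_exponent t))\<^sup>2"
    proof -
      have "(real n powr decay_exponent t)\<^sup>2 = real n powr (2 * decay_exponent t)"
        using n by (simp add: power2_eq_square flip: powr_add)
      moreover have "K\<^sup>2 = C * (K0 + 1)" using C K0 by (simp add: K_def)
      moreover have "(t\<^sup>2)\<^sup>2 = t ^ 4" by simp
      ultimately show ?thesis unfolding power_mult_distrib G_def by (simp add: mult_ac)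
    qed
    finally show ?thesis by (simp only: power_mult)
  qed
  moreover have "K > 0" using C K0 by (simp add: K_def)
  ultimately show ?thesis by blast
qed

text \<open>The case a n = 1, beta = 0 of the recursion: increments are at most the weight over n,
  so their squared norms are at most a multiple of n^(1/4 - 2), below n^(-5/4).\<close>

lemma depth_dev_moment:
  "\<exists>K>0. \<forall>n\<ge>1. mean n (\<lambda>E. depth_dev n E ^ (2 * Suc p)) \<le> K"
proof -
  obtain C where C: "C > 0" and rec: "\<And>(X :: nat \<Rightarrow> (nat \<times> nat) set \<Rightarrow> complex) a d G \<beta> n.
     G > 0 \<Longrightarrow> (\<And>E. X 1 E = 0) \<Longrightarrow>
     (\<And>n E u. n \<ge> 1 \<Longrightarrow> E \<in> recursive_trees n \<Longrightarrow> u \<in> {1..n} \<Longrightarrow>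
        X (Suc n) (insert (u, Suc n) E) = a n * X n E + d n E u) \<Longrightarrow>
     (\<And>n E. n \<ge> 1 \<Longrightarrow> E \<in> recursive_trees n \<Longrightarrow> (\<Sum>u=1..n. d n E u) = 0) \<Longrightarrow>
     (\<And>n. n \<ge> 1 \<Longrightarrow> cmod (a n) \<le> (real (Suc n) / real n) powr \<beta>) \<Longrightarrow>
     (\<And>n. n \<ge> 1 \<Longrightarrow> mean n (\<lambda>E. avg n (\<lambda>u. cmod (d n E u) ^ (2 * Suc p)))
         \<le> (G * real (Suc n) powr (2 * \<beta>) * real n powr (-5/4)) ^ Suc p) \<Longrightarrow>
     n \<ge> 1 \<Longrightarrow> mean n (\<lambda>E. cmod (X n E) ^ (2 * Suc p)) \<le> (C * G * real n powr (2 * \<beta>)) ^ Suc p"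
    by (fact moment_recursion[of p])
  obtain K0 where K0: "K0 > 0" "\<And>n. n \<ge> 1 \<Longrightarrow>
      mean n (\<lambda>E. avg n (\<lambda>u. level_weight n E u ^ (2 * Suc p))) \<le> K0 * real n powr (1/4)"
    using level_weight_moment[of "2 * p + 1"] by auto
  define d where "d n E u = complex_of_real ((real (level E u) - mean_level n E) / real (Suc n))" for n E u
  have "mean n (\<lambda>E. depth_dev n E ^ (2 * Suc p)) \<le> (C * (K0 + 1)) ^ Suc p" if n: "n \<ge> 1" for n
  proof -
    have "mean n (\<lambda>E. cmod (complex_of_real (depth_dev n E)) ^ (2 * Suc p))
        \<le> (C * (K0 + 1) * real n powr (2 * 0)) ^ Suc p"
    proof (rule rec[where X = "\<lambda>n E. of_real (depth_dev n E)" and a = "\<lambda>n. 1" and d = d, OF _ _ _ _ _ _ n])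
      show "K0 + 1 > 0" using K0 by simp
      show "complex_of_real (depth_dev 1 E) = 0" for E
        by (simp add: depth_dev_1[simplified])
      show "complex_of_real (depth_dev (Suc n) (insert (u, Suc n) E)) = 1 * of_real (depth_dev n E) + d n E u"
        if "1 \<le> n" "E \<in> recursive_trees n" "u \<in> {1..n}" for n E u
        unfolding depth_dev_insert[OF that] d_def by simp
      show "(\<Sum>u=1..n. d n E u) = 0" if "1 \<le> n" for n E
      proof -
        have "(\<Sum>u=1..n. d n E u) = of_real ((\<Sum>u=1..n. real (level E u) - mean_level n E) / real (Suc n))"
          unfolding d_def sum_divide_distrib of_real_sum ..
        thus ?thesis unfolding sum_level_deviation[OF that] by simp
      qed
      show "cmod 1 \<le> (real (Suc n) / real n) powr 0" if "1 \<le> n" for n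
        using that by simp
      fix n :: nat
      assume n: "n \<ge> 1"
      have "mean n (\<lambda>E. avg n (\<lambda>u. cmod (d n E u) ^ (2 * Suc p)))
          \<le> mean n (\<lambda>E. avg n (\<lambda>u. (1 / real n) ^ (2 * Suc p) * level_weight n E u ^ (2 * Suc p)))"
      proof (intro mean_mono avg_mono)
        fix E u
        have "cmod (d n E u) = \<bar>real (level E u) - mean_level n E\<bar> / real (Suc n)"
          unfolding d_def norm_of_real by simp
        also have "\<dots> \<le> level_weight n E u / real n"
          using level_deviation_le_weight[OF n] level_weight_nonneg n by (intro frac_le) auto
        finally have "cmod (d n E u) ^ (2 * Suc p) \<le> (1 / real n * level_weight n E u) ^ (2 * Suc p)"
          by (intro power_mono) auto
        thus "cmod (d n E u) ^ (2 * Suc p) \<le> (1 / real n) ^ (2 * Suc p) * level_weight n E u ^ (2 * Suc p)"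
          by (simp only: power_mult_distrib)
      qed
      also have "\<dots> \<le> (1 / real n) ^ (2 * Suc p) * (K0 * real n powr (1/4))"
        unfolding avg_cmult mean_cmult by (intro mult_left_mono K0 n) auto
      also have "\<dots> = K0 * real n powr (1/4 - real (2 * Suc p))"
      proof -
        have "(1 / real n) ^ k = real n powr (- real k)" for k
          using n by (simp add: powr_minus powr_realpow power_one_over inverse_eq_divide)
        moreover have "a * (K0 * b) = K0 * (b * a)" for a b :: real by simp
        ultimately show ?thesis
          by (simp only: powr_add[symmetric] diff_conv_add_uminus)
      qed
      also have "\<dots> \<le> (K0 + 1) ^ Suc p * real n powr (-5/4 * real (Suc p))"
      proof (rule mult_mono)
        have "K0 + 1 \<le> (K0 + 1) ^ Suc p" using K0 by (intro self_le_power) auto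
        thus "K0 \<le> (K0 + 1) ^ Suc p" by linarith
        show "real n powr (1/4 - real (2 * Suc p)) \<le> real n powr (-5/4 * real (Suc p))"
        proof (rule powr_mono)
          have "1/4 - 2 * x \<le> -5/4 * x" if "x \<ge> 1" for x :: real
            using that by (simp add: field_simps)
          from this[of "real (Suc p)"] show "1/4 - real (2 * Suc p) \<le> -5/4 * real (Suc p)"
            by simp
        qed (use n in simp)
      qed (use K0 in auto)
      also have "\<dots> = ((K0 + 1) * real (Suc n) powr (2 * 0) * real n powr (-5/4)) ^ Suc p"
        using n powr_power[of "real n" "-5/4" "Suc p"] unfolding power_mult_distrib
        by (simp add: mult.commute del: power_Suc)
      finally show "mean n (\<lambda>E. avg n (\<lambda>u. cmod (d n E u) ^ (2 * Suc p)))
          \<le> ((K0 + 1) * real (Suc n) powr (2 * 0) * real n powr (-5/4)) ^ Suc p" .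
    qed
    moreover have "cmod (complex_of_real x) ^ (2 * Suc p) = x ^ (2 * Suc p)" for x
      unfolding norm_of_real power_mult power2_abs ..
    ultimately show ?thesis using n by simp
  qed
  moreover have "(C * (K0 + 1)) ^ Suc p > 0" using C K0 by simp
  ultimately show ?thesis by blast
qed

section \<open>Coefficients from values on the unit circle\<close>

lemma has_integral_cis_int:
  "((\<lambda>t. cis (of_int m * t)) has_integral (if m = 0 then of_real (2 * pi) else 0)) {-pi..pi}"
proof (cases "m = 0")
  case True
  thus ?thesis using has_integral_const_real[of "1::complex" "-pi" pi]
    by (simp add: scaleR_conv_of_real)
next
  case False
  define F where "F t = cis (of_int m * t) / (\<i> * of_int m)" for t
  have "((\<lambda>t. cis (of_int m * t)) has_integral (F pi - F (-pi))) {-pi..pi}"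
  proof (rule fundamental_theorem_of_calculus)
    fix t assume "t \<in> {-pi..pi}"
    have "((\<lambda>t. cis (of_int m * t)) has_vector_derivative (of_int m * (\<i> * cis (of_int m * t)))) (at t within {-pi..pi})"
      unfolding cis_conv_exp
      by (auto intro!: derivative_eq_intros has_vector_derivative_real_field simp: mult_ac)
    from has_vector_derivative_divide[OF this, of "\<i> * of_int m"]
    show "(F has_vector_derivative cis (of_int m * t)) (at t within {-pi..pi})"
      using False by (simp add: F_def[abs_def])
  qed simp
  moreover have "cis (of_int m * pi) = cis (of_int m * (-pi))"
    by (simp add: complex_eq_iff mult.commute[of _ pi])
  ultimately show ?thesis using False by (simp add: F_def)
qed

text \<open>Cauchy's coefficient formula, by orthogonality of the characters. The bound is the same
  for all k, which makes all later estimates uniform in the level.\<close>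

lemma norm_coeff_le_integral:
  fixes p :: "complex poly"
  shows "cmod (coeff p k) \<le> integral {-pi..pi} (\<lambda>t. cmod (poly p (cis t))) / (2 * pi)"
proof -
  define g where "g t = poly p (cis t) * cis (of_int (- int k) * t)" for t
  have g: "g t = (\<Sum>j\<le>degree p. coeff p j * cis (of_int (int j - int k) * t))" for t
    unfolding g_def poly_altdef sum_distrib_right mult.assoc
    by (intro sum.cong refl) (simp add: Complex.DeMoivre cis_mult algebra_simps)
  have "(g has_integral (\<Sum>j\<le>degree p. coeff p j * (if int j - int k = 0 then of_real (2 * pi) else 0))) {-pi..pi}"
    unfolding g[abs_def] by (intro has_integral_sum has_integral_mult_right has_integral_cis_int) auto
  moreover have "(\<Sum>j\<le>degree p. coeff p j * (if int j - int k = 0 then of_real (2 * pi) else 0))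
      = coeff p k * of_real (2 * pi)"
  proof -
    have "(\<Sum>j\<le>degree p. coeff p j * (if int j - int k = 0 then of_real (2 * pi) else 0))
       = (\<Sum>j\<le>degree p. if j = k then coeff p k * complex_of_real (2 * pi) else 0)"
      by (intro sum.cong) auto
    thus ?thesis by (simp add: coeff_eq_0)
  qed
  ultimately have int: "(g has_integral (coeff p k * of_real (2 * pi))) {-pi..pi}" by simp
  have cont: "continuous_on {-pi..pi} (\<lambda>t. cmod (poly p (cis t)))"
    by (intro continuous_intros)
  have "cmod (integral {-pi..pi} g) \<le> integral {-pi..pi} (\<lambda>t. cmod (poly p (cis t)))"
  proof (rule integral_norm_bound_integral)
    show "g integrable_on {-pi..pi}" using int by blast
    show "(\<lambda>t. cmod (poly p (cis t))) integrable_on {-pi..pi}"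
      using cont by (rule integrable_continuous_real)
  qed (simp add: g_def norm_mult)
  hence "cmod (coeff p k) * (2 * pi) \<le> integral {-pi..pi} (\<lambda>t. cmod (poly p (cis t)))"
    unfolding integral_unique[OF int] by (simp add: norm_mult)
  thus ?thesis by (simp add: field_simps)
qed

section \<open>Integral estimates\<close>

text \<open>Jensen for f / w under the probability density w / W, where W is the integral of w and x
  the resulting mean.\<close>

lemma integral_power_le:
  fixes f w :: "real \<Rightarrow> real"
  assumes f: "continuous_on {a..b} f" "\<And>t. t \<in> {a..b} \<Longrightarrow> f t \<ge> 0"
    and w: "continuous_on {a..b} w" "\<And>t. t \<in> {a..b} \<Longrightarrow> w t > 0"
    and I: "integral {a..b} w > 0"
  shows "integral {a..b} f ^ Suc q
    \<le> integral {a..b} w ^ q * integral {a..b} (\<lambda>t. f t ^ Suc q / w t ^ q)"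
proof -
  define W where "W = integral {a..b} w"
  define x where "x = integral {a..b} f / W"
  have W: "W > 0" using I by (simp add: W_def)
  have intF: "integral {a..b} f = x * W" using W by (simp add: x_def)
  have x: "x \<ge> 0"
    unfolding x_def using W f by (intro divide_nonneg_pos integral_nonneg integrable_continuous_real) auto
  have "integral {a..b} (\<lambda>t. x ^ Suc q * w t + real (Suc q) * x ^ q * (f t - x * w t))
      \<le> integral {a..b} (\<lambda>t. f t ^ Suc q / w t ^ q)"
  proof (rule integral_le)
    show "(\<lambda>t. x ^ Suc q * w t + real (Suc q) * x ^ q * (f t - x * w t)) integrable_on {a..b}"
      by (intro integrable_continuous_real continuous_intros f w)
    show "(\<lambda>t. f t ^ Suc q / w t ^ q) integrable_on {a..b}"
      using w(2) by (intro integrable_continuous_real continuous_intros f w) force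
  next
    fix t assume t: "t \<in> {a..b}"
    have wt: "w t > 0" using w(2)[OF t] .
    have "w t * (x ^ Suc q + real (Suc q) * x ^ q * (f t / w t - x)) \<le> w t * (f t / w t) ^ Suc q"
      using wt f(2)[OF t] x by (intro mult_left_mono power_ge_tangent) auto
    moreover have "w t * (f t / w t) ^ Suc q = f t ^ Suc q / w t ^ q"
      using wt by (simp add: power_divide)
    moreover have "w t * (x ^ Suc q + real (Suc q) * x ^ q * (f t / w t - x))
        = x ^ Suc q * w t + real (Suc q) * x ^ q * (f t - x * w t)"
    proof -
      have "w t * (f t / w t - x) = f t - x * w t" using wt by (simp add: algebra_simps)
      moreover have "w t * (A + B * c) = A * w t + B * (w t * c)" for A B c :: real
        by (simp add: algebra_simps)
      ultimately show ?thesis by simp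
    qed
    ultimately show "x ^ Suc q * w t + real (Suc q) * x ^ q * (f t - x * w t) \<le> f t ^ Suc q / w t ^ q"
      by linarith
  qed
  moreover have "integral {a..b} (\<lambda>t. x ^ Suc q * w t + real (Suc q) * x ^ q * (f t - x * w t)) = x ^ Suc q * W"
  proof -
    have "w integrable_on {a..b}" "f integrable_on {a..b}"
      by (intro integrable_continuous_real f w)+
    hence "((\<lambda>t. x ^ Suc q * w t + real (Suc q) * x ^ q * (f t - x * w t))
        has_integral (x ^ Suc q * W + real (Suc q) * x ^ q * (x * W - x * W))) {a..b}"
      unfolding W_def by (intro has_integral_add has_integral_mult_right has_integral_diff)
        (use intF W_def in \<open>auto simp: has_integral_iff\<close>)
    thus ?thesis by (simp add: integral_unique)
  qed
  ultimately have "W ^ q * (x ^ Suc q * W) \<le> W ^ q * integral {a..b} (\<lambda>t. f t ^ Suc q / w t ^ q)"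
    using W by (intro mult_left_mono) auto
  moreover have "W ^ q * (x ^ Suc q * W) = integral {a..b} f ^ Suc q"
    unfolding intF by (simp add: power_mult_distrib mult_ac)
  ultimately show ?thesis by (simp add: W_def)
qed

lemma mean_integral:
  assumes "\<And>E. E \<in> recursive_trees n \<Longrightarrow> (\<lambda>t. g E t) integrable_on S" "n \<ge> 1"
  shows "mean n (\<lambda>E. integral S (g E)) = integral S (\<lambda>t. mean n (\<lambda>E. g E t))"
proof -
  have "integral S (\<lambda>t. mean n (\<lambda>E. g E t))
      = integral S (\<lambda>t. \<Sum>E\<in>recursive_trees n. g E t) / fact (n - 1)"
    unfolding mean_def by (rule integral_divide)
  also have "integral S (\<lambda>t. \<Sum>E\<in>recursive_trees n. g E t) = (\<Sum>E\<in>recursive_trees n. integral S (g E))"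
    by (rule integral_sum) (use assms finite_recursive_trees in auto)
  finally show ?thesis by (simp add: mean_def)
qed

text \<open>Minkowski's integral inequality in the needed form: norms of f at t of at most K w(t)
  integrate to a bound for the norm of the integral. With w explicit, Jensen suffices.\<close>

lemma mean_integral_power_le:
  fixes f :: "(nat \<times> nat) set \<Rightarrow> real \<Rightarrow> real"
  assumes n: "n \<ge> 1"
    and f: "\<And>E. continuous_on {a..b} (f E)" "\<And>E t. t \<in> {a..b} \<Longrightarrow> f E t \<ge> 0"
    and w: "continuous_on {a..b} w" "\<And>t. t \<in> {a..b} \<Longrightarrow> w t > 0"
    and I: "integral {a..b} w > 0" and K: "K \<ge> 0"
    and bound: "\<And>t. t \<in> {a..b} \<Longrightarrow> mean n (\<lambda>E. f E t ^ Suc q) \<le> (K * w t) ^ Suc q"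
  shows "mean n (\<lambda>E. integral {a..b} (f E) ^ Suc q) \<le> (K * integral {a..b} w) ^ Suc q"
proof -
  define W where "W = integral {a..b} w"
  have W: "W > 0" using I by (simp add: W_def)
  have int: "(\<lambda>t. f E t ^ Suc q / w t ^ q) integrable_on {a..b}" for E
    using w(2) by (intro integrable_continuous_real continuous_intros f w) force
  have "mean n (\<lambda>E. integral {a..b} (f E) ^ Suc q)
      \<le> mean n (\<lambda>E. W ^ q * integral {a..b} (\<lambda>t. f E t ^ Suc q / w t ^ q))"
    unfolding W_def by (intro mean_mono integral_power_le f w I)
  also have "\<dots> = W ^ q * integral {a..b} (\<lambda>t. mean n (\<lambda>E. f E t ^ Suc q / w t ^ q))"
    unfolding mean_cmult by (subst mean_integral) (use int n in auto)
  also have "integral {a..b} (\<lambda>t. mean n (\<lambda>E. f E t ^ Suc q / w t ^ q))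
      \<le> integral {a..b} (\<lambda>t. K ^ Suc q * w t)"
  proof (rule integral_le)
    show "(\<lambda>t. mean n (\<lambda>E. f E t ^ Suc q / w t ^ q)) integrable_on {a..b}"
      unfolding mean_def using int finite_recursive_trees[OF n]
      by (intro integrable_on_divide integrable_sum) auto
    show "(\<lambda>t. K ^ Suc q * w t) integrable_on {a..b}"
      by (intro integrable_continuous_real continuous_intros w)
  next
    fix t assume t: "t \<in> {a..b}"
    have wt: "w t > 0" using w(2)[OF t] .
    have "mean n (\<lambda>E. f E t ^ Suc q / w t ^ q) = mean n (\<lambda>E. f E t ^ Suc q) / w t ^ q"
      unfolding mean_def by (simp add: sum_divide_distrib mult.commute del: power_Suc)
    also have "\<dots> \<le> (K * w t) ^ Suc q / w t ^ q"
      using bound[OF t] wt by (intro divide_right_mono) auto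
    also have "\<dots> = K ^ Suc q * w t" using wt by (simp add: power_mult_distrib)
    finally show "mean n (\<lambda>E. f E t ^ Suc q / w t ^ q) \<le> K ^ Suc q * w t" .
  qed
  hence "W ^ q * integral {a..b} (\<lambda>t. mean n (\<lambda>E. f E t ^ Suc q / w t ^ q)) \<le> W ^ q * (K ^ Suc q * W)"
    using W by (intro mult_left_mono) (auto simp: W_def)
  also have "W ^ q * (K ^ Suc q * W) = (K * W) ^ Suc q" by (simp add: power_mult_distrib mult_ac)
  finally show ?thesis by (simp add: W_def)
qed

section \<open>An explicit integrable majorant\<close>

lemma mult_exp_minus_le:
  fixes y :: real
  assumes "y \<ge> 0"
  shows "y * exp (-y) \<le> 2 / (1 + y)"
proof -
  have "y * (1 + y) \<le> 2 * exp y"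
    using exp_lower_Taylor_quadratic[OF assms] assms by (simp add: power2_eq_square algebra_simps)
  thus ?thesis using assms by (simp add: exp_minus field_simps)
qed

text \<open>With y = t^2 ln n / 48, the bound y exp(-y) <= 2/(1 + y) turns t^2 n^(1 - t^2/48) into
  this rational function; 96 is 2 times 48. Unlike the original it is positive at t = 0, as a weight
  for Jensen must be, and its antiderivative is an arctangent.\<close>

definition envelope :: "nat \<Rightarrow> real \<Rightarrow> real" where
  "envelope n t = 96 * real n / (ln n * (1 + ln n * t\<^sup>2 / 48))"

lemma decay_le_envelope:
  assumes "n \<ge> 2"
  shows "t\<^sup>2 * real n powr decay_exponent t \<le> envelope n t"
proof -
  define l where "l = ln (real n)"
  define y where "y = l * t\<^sup>2 / 48"
  have l: "l > 0" and y: "y \<ge> 0" using assms by (auto simp: l_def y_def)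
  have "real n powr decay_exponent t = real n * exp (- y)"
  proof -
    have "decay_exponent t * l = l + - y" by (simp add: decay_exponent_def y_def algebra_simps)
    hence "real n powr decay_exponent t = exp (l + - y)" using assms by (simp add: powr_def l_def)
    also have "\<dots> = exp l * exp (- y)" by (rule exp_add)
    finally show ?thesis using assms by (simp add: l_def)
  qed
  hence "t\<^sup>2 * real n powr decay_exponent t = 48 * real n / l * (y * exp (- y))"
    using l by (simp add: y_def)
  also have "\<dots> \<le> 48 * real n / l * (2 / (1 + y))"
    using l by (intro mult_left_mono mult_exp_minus_le y) auto
  finally show ?thesis by (simp add: envelope_def l_def y_def)
qed

lemma envelope_pos: "n \<ge> 2 \<Longrightarrow> envelope n t > 0"
  unfolding envelope_def by (intro divide_pos_pos mult_pos_pos add_pos_nonneg) auto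

lemma continuous_on_envelope: "n \<ge> 2 \<Longrightarrow> continuous_on A (envelope n)"
proof -
  assume n: "n \<ge> 2"
  have "ln (real n) * (1 + ln (real n) * t\<^sup>2 / 48) \<noteq> 0" for t
  proof -
    have "ln (real n) * (1 + ln (real n) * t\<^sup>2 / 48) > 0"
      using n by (intro mult_pos_pos add_pos_nonneg) auto
    thus ?thesis by (metis less_irrefl)
  qed
  thus ?thesis unfolding envelope_def[abs_def] by (intro continuous_intros) auto
qed

text \<open>Substituting c t with c = sqrt (ln n / 48) yields a factor of order (ln n)^(-1/2), and
  the prefactor is n / ln n: together the exponent -3/2.\<close>

lemma integral_envelope:
  assumes "n \<ge> 2"
  shows "integral {-pi..pi} (envelope n) > 0"
    and "integral {-pi..pi} (envelope n) \<le> 96 * pi * sqrt 48 * (real n * ln n powr (-3/2))"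
proof -
  define l where "l = ln (real n)"
  have l: "l > 0" using assms by (simp add: l_def)
  define c where "c = sqrt (l / 48)"
  have c: "c > 0" "c\<^sup>2 = l / 48" using l by (simp_all add: c_def)
  define F where "F t = 96 * real n / (l * c) * arctan (c * t)" for t
  have F: "(envelope n has_integral (F pi - F (-pi))) {-pi..pi}"
  proof (rule fundamental_theorem_of_calculus)
    fix t :: real
    have "(F has_real_derivative 96 * real n / (l * c) * (inverse (1 + (c * t)\<^sup>2) * c)) (at t)"
      unfolding F_def using l c(1) by (auto intro!: derivative_eq_intros)
    moreover have "96 * real n / (l * c) * (inverse (1 + (c * t)\<^sup>2) * c) = envelope n t"
      using c l by (simp add: envelope_def power_mult_distrib l_def[symmetric] inverse_eq_divide)
    ultimately show "(F has_vector_derivative envelope n t) (at t within {-pi..pi})"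
      by (simp add: has_real_derivative_iff_has_vector_derivative has_vector_derivative_at_within)
  qed simp
  have val: "F pi - F (-pi) = 192 * real n / (l * c) * arctan (c * pi)"
    by (simp add: F_def arctan_minus mult_ac)
  show "integral {-pi..pi} (envelope n) > 0"
    unfolding integral_unique[OF F] val using assms l c by (intro mult_pos_pos) auto
  have "192 * real n / (l * c) * arctan (c * pi) \<le> 192 * real n / (l * c) * (pi / 2)"
    using l c arctan_ubound[of "c * pi"] by (intro mult_left_mono) auto
  also have "\<dots> = 96 * pi * sqrt 48 * (real n * (1 / (l * sqrt l)))"
    by (simp add: c_def real_sqrt_divide)
  also have "1 / (l * sqrt l) = l powr (-3/2)"
  proof -
    have "l powr (3/2) = l powr 1 * l powr (1/2)" using powr_add[of l 1 "1/2"] by simp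
    thus ?thesis using l by (simp add: powr_minus powr_half_sqrt inverse_eq_divide)
  qed
  finally show "integral {-pi..pi} (envelope n) \<le> 96 * pi * sqrt 48 * (real n * ln n powr (-3/2))"
    unfolding integral_unique[OF F] val l_def .
qed

text \<open>Walking an integer distance \<open>i\<close> from \<open>k\<close>, the function differs from its tangent at \<open>k\<close> by
  at most \<open>D i\<^sup>2\<close>; so a linear extrapolation cannot exceed the maximum by more than that.\<close>

lemma linear_extrapolation_le:
  fixes f :: "int \<Rightarrow> real" and m :: real
  assumes diff2: "\<And>k. \<bar>f k - 2 * f (k - 1) + f (k - 2)\<bar> \<le> D"
    and le: "\<And>k. f k \<le> M"
  shows "f k - m * (f k - f (k - 1)) \<le> M + 2 * D * (1 + m\<^sup>2)"
proof -
  define d where "d k = f k - f (k - 1)" for k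
  have D: "D \<ge> 0" using diff2[of 0] by linarith
  have step: "\<bar>d i - d (i - 1)\<bar> \<le> D" for i
    using diff2[of i] by (simp add: d_def algebra_simps)
  have slope_down: "\<bar>d (k - int j) - d k\<bar> \<le> real j * D" for j
  proof (induction j)
    case (Suc j)
    thus ?case using step[of "k - int j"] by (simp add: algebra_simps)
  qed simp
  have slope_up: "\<bar>d (k + int j) - d k\<bar> \<le> real j * D" for j
  proof (induction j)
    case (Suc j)
    thus ?case using step[of "k + int (Suc j)"] by (simp add: algebra_simps)
  qed simp
  have down: "\<bar>f (k - int j) - (f k - real j * d k)\<bar> \<le> D * (real j)\<^sup>2" for j
  proof (induction j)
    case (Suc j)
    have "f (k - int (Suc j)) = f (k - int j) - d (k - int j)" by (simp add: d_def algebra_simps)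
    hence "\<bar>f (k - int (Suc j)) - (f k - real (Suc j) * d k)\<bar>
        \<le> \<bar>f (k - int j) - (f k - real j * d k)\<bar> + \<bar>d (k - int j) - d k\<bar>"
      by (simp add: algebra_simps)
    also have "\<dots> \<le> D * (real j)\<^sup>2 + real j * D" by (intro add_mono Suc.IH slope_down)
    also have "\<dots> \<le> D * (real (Suc j))\<^sup>2" using D by (simp add: power2_eq_square algebra_simps)
    finally show ?case .
  qed simp
  have up: "\<bar>f (k + int j) - (f k + real j * d k)\<bar> \<le> D * (real j)\<^sup>2" for j
  proof (induction j)
    case (Suc j)
    have "f (k + int (Suc j)) = f (k + int j) + d (k + int (Suc j))" by (simp add: d_def algebra_simps)
    hence "\<bar>f (k + int (Suc j)) - (f k + real (Suc j) * d k)\<bar>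
        \<le> \<bar>f (k + int j) - (f k + real j * d k)\<bar> + \<bar>d (k + int (Suc j)) - d k\<bar>"
      by (simp add: algebra_simps)
    also have "\<dots> \<le> D * (real j)\<^sup>2 + real (Suc j) * D" by (intro add_mono Suc.IH slope_up)
    also have "\<dots> \<le> D * (real (Suc j))\<^sup>2" using D by (simp add: power2_eq_square algebra_simps)
    finally show ?case .
  qed simp
  have int: "f k - of_int i * d k \<le> M + D * (of_int i)\<^sup>2" for i
  proof (cases "i \<ge> 0")
    case True
    then obtain j where j: "i = int j" using nonneg_int_cases by blast
    show ?thesis using down[of j] le[of "k - int j"] by (simp add: j)
  next
    case False
    then obtain j where j: "i = - int j" by (metis int_cases4 nat_le_linear of_nat_0_le_iff)
    show ?thesis using up[of j] le[of "k + int j"] by (simp add: j)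
  qed
  \<comment> \<open>The left side is affine in m, so the bounds at the two neighbouring integers
    interpolate.\<close>
  define i where "i = \<lfloor>m\<rfloor>"
  define \<theta> where "\<theta> = m - of_int i"
  have th: "0 \<le> \<theta>" "\<theta> \<le> 1" by (auto simp: \<theta>_def i_def) linarith
  have sq: "(of_int i)\<^sup>2 \<le> 2 * (1 + m\<^sup>2)" "(of_int (i + 1))\<^sup>2 \<le> 2 * (1 + m\<^sup>2)"
  proof -
    have "\<bar>real_of_int i\<bar> \<le> 1 + \<bar>m\<bar>" "\<bar>real_of_int (i + 1)\<bar> \<le> 1 + \<bar>m\<bar>"
      using th by (auto simp: \<theta>_def)
    hence "\<bar>real_of_int i\<bar>\<^sup>2 \<le> (1 + \<bar>m\<bar>)\<^sup>2" "\<bar>real_of_int (i + 1)\<bar>\<^sup>2 \<le> (1 + \<bar>m\<bar>)\<^sup>2"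
      by (intro power_mono; simp)+
    moreover have "(1 + \<bar>m\<bar>)\<^sup>2 \<le> 2 * (1 + m\<^sup>2)"
      using zero_le_power2[of "1 - \<bar>m\<bar>"] by (simp add: power2_eq_square algebra_simps)
    ultimately show "(of_int i)\<^sup>2 \<le> 2 * (1 + m\<^sup>2)" "(of_int (i + 1))\<^sup>2 \<le> 2 * (1 + m\<^sup>2)"
      by (simp_all only: power2_abs)
  qed
  let ?B = "M + D * (2 * (1 + m\<^sup>2))"
  have "f k - of_int i * d k \<le> ?B"
    using int[of i] mult_left_mono[OF sq(1) D] by linarith
  moreover have "f k - of_int (i + 1) * d k \<le> ?B"
    using int[of "i + 1"] mult_left_mono[OF sq(2) D] by linarith
  ultimately have "(1 - \<theta>) * (f k - of_int i * d k) + \<theta> * (f k - of_int (i + 1) * d k)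
      \<le> (1 - \<theta>) * ?B + \<theta> * ?B"
    using th by (intro add_mono mult_left_mono) auto
  moreover have "(1 - \<theta>) * (f k - of_int i * d k) + \<theta> * (f k - of_int (i + 1) * d k) = f k - m * d k"
    by (simp add: \<theta>_def algebra_simps)
  ultimately show ?thesis by (simp add: d_def algebra_simps)
qed

section \<open>The width\<close>

text \<open>A formal polynomial, since the profile is read off from coefficients and
  \<open>level_poly\<close> has only values.\<close>

definition profile_poly :: "nat \<Rightarrow> (nat \<times> nat) set \<Rightarrow> complex poly" where
  "profile_poly n E = (\<Sum>v=1..n. monom 1 (level E v))"

definition mu_poly :: "nat \<Rightarrow> complex poly" where
  "mu_poly n = (\<Prod>j=1..<n. [:1, 1 / of_nat j:])"

text \<open>The expected number of nodes at level \<open>k\<close>.\<close>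

definition mu :: "nat \<Rightarrow> int \<Rightarrow> real" where
  "mu n k = (if k < 0 then 0 else Re (coeff (mu_poly n) (nat k)))"

lemma mu_int:
  "mu n (int k) = Re (coeff (mu_poly n) k)"
  "mu n (int k - 1) = (if k = 0 then 0 else Re (coeff (mu_poly n) (k - 1)))"
  "mu n (int k - 2) = (if k < 2 then 0 else Re (coeff (mu_poly n) (k - 2)))"
  by (auto simp: mu_def nat_diff_distrib)

lemma poly_profile_poly: "poly (profile_poly n E) z = level_poly n E z"
  by (simp add: profile_poly_def level_poly_def poly_sum poly_monom)

lemma poly_mu_poly: "poly (mu_poly n) z = mean_poly n z"
  by (simp add: mu_poly_def mean_poly_def poly_prod)

lemma coeff_profile_poly: "coeff (profile_poly n E) k = of_nat (profile n E k)"
proof -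
  have "coeff (profile_poly n E) k = (\<Sum>v\<in>{1..n}. if level E v = k then 1 else 0)"
    by (simp add: profile_poly_def coeff_sum)
  also have "\<dots> = of_nat (card ({1..n} \<inter> {v. level E v = k}))"
    by (simp only: sum.inter_filter[symmetric] finite_atLeastAtMost Collect_conj_eq[symmetric])
       (simp add: Int_def)
  also have "{1..n} \<inter> {v. level E v = k} = {v \<in> {1..n}. level E v = k}" by auto
  finally show ?thesis by (simp add: profile_def)
qed

text \<open>This is how factors z - 1 on the circle become differences in the level k.\<close>

lemma coeff_difference_mult:
  fixes q :: "complex poly"
  shows "coeff ([:-1, 1:] * q) k = (if k = 0 then 0 else coeff q (k - 1)) - coeff q k"
  by (simp add: mult_pCons_left coeff_pCons split: nat.split)

text \<open>A single number bounding all coefficients of the remainder, so no union over levels is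
  needed.\<close>

definition sup_error :: "nat \<Rightarrow> (nat \<times> nat) set \<Rightarrow> real" where
  "sup_error n E = integral {-pi..pi} (\<lambda>t. cmod (remainder n E (cis t))) / (2 * pi)"

lemma continuous_on_remainder: "continuous_on A (\<lambda>t. cmod (remainder n E (cis t)))"
proof -
  have "(\<lambda>t. cmod (remainder n E (cis t))) = (\<lambda>t. cmod (poly (profile_poly n E) (cis t)
      - poly (mu_poly n) (cis t) - (cis t - 1) * of_real (depth_dev n E) * poly (mu_poly n) (cis t)))"
    by (simp add: remainder_def poly_profile_poly poly_mu_poly)
  thus ?thesis by (simp only:) (intro continuous_intros)
qed

lemma sup_error_nonneg: "0 \<le> sup_error n E"
  unfolding sup_error_def
  by (intro divide_nonneg_nonneg integral_nonneg integrable_continuous_real continuous_on_remainder) auto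

text \<open>Compare coefficients in \<open>remainder\<close>: (z - 1) P has coefficient mu_(k-1) -
  mu_k, whence the minus sign before the linear term.\<close>

lemma profile_approx:
  "\<bar>real (profile n E k) - (mu n (int k) - depth_dev n E * (mu n (int k) - mu n (int k - 1)))\<bar>
     \<le> sup_error n E"
proof -
  define R where "R = profile_poly n E - mu_poly n
      - smult (of_real (depth_dev n E)) ([:-1, 1:] * mu_poly n)"
  have poly: "poly R z = remainder n E z" for z
    by (simp add: R_def remainder_def poly_profile_poly poly_mu_poly algebra_simps)
  have "Re (coeff R k) = real (profile n E k) - (mu n (int k) - depth_dev n E * (mu n (int k) - mu n (int k - 1)))"
    unfolding R_def coeff_diff coeff_smult coeff_difference_mult coeff_profile_poly mu_int
    by (simp add: algebra_simps)
  moreover have "\<bar>Re (coeff R k)\<bar> \<le> sup_error n E"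
    using order_trans[OF abs_Re_le_cmod norm_coeff_le_integral[of R k]]
    by (simp add: poly sup_error_def)
  ultimately show ?thesis by simp
qed

text \<open>Second differences are coefficients of (z - 1)^2 P, and |z - 1|^2 |P| obeys the bound
  t^2 n^(1 - t^2/48) that also governs the remainder.\<close>

lemma mu_second_difference:
  assumes "n \<ge> 2"
  shows "\<bar>mu n k - 2 * mu n (k - 1) + mu n (k - 2)\<bar> \<le> integral {-pi..pi} (envelope n)"
proof (cases "k < 0")
  case True
  thus ?thesis using integral_envelope(1)[OF assms] by (simp add: mu_def)
next
  case False
  then obtain j where j: "k = int j" using nonneg_int_cases[of k] by auto
  define R where "R = [:-1, 1:] * ([:-1, 1:] * mu_poly n)"
  have "Re (coeff R j) = mu n k - 2 * mu n (k - 1) + mu n (k - 2)"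
    unfolding R_def coeff_difference_mult j mu_int by (cases "j < 2") (auto simp: numeral_2_eq_2)
  moreover have "cmod (coeff R j) \<le> integral {-pi..pi} (envelope n)"
  proof -
    have "cmod (coeff R j) \<le> integral {-pi..pi} (\<lambda>t. cmod (poly R (cis t))) / (2 * pi)"
      by (rule norm_coeff_le_integral)
    also have "\<dots> \<le> integral {-pi..pi} (envelope n) / (2 * pi)"
    proof (intro divide_right_mono integral_le)
      show "(\<lambda>t. cmod (poly R (cis t))) integrable_on {-pi..pi}"
        by (intro integrable_continuous_real continuous_intros)
      show "envelope n integrable_on {-pi..pi}"
        by (intro integrable_continuous_real continuous_on_envelope assms)
      fix t assume t: "t \<in> {-pi..pi}"
      have "cmod (poly R (cis t)) = (cmod (cis t - 1))\<^sup>2 * cmod (mean_poly n (cis t))"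
      proof -
        have "poly R (cis t) = (cis t - 1) * (cis t - 1) * mean_poly n (cis t)"
          by (simp add: R_def poly_mu_poly algebra_simps)
        thus ?thesis by (simp add: norm_mult power2_eq_square)
      qed
      also have "\<dots> \<le> \<bar>t\<bar>\<^sup>2 * real n powr decay_exponent t"
        using t assms by (intro mult_mono power_mono norm_cis_minus_one_le norm_mean_poly_cis_le) auto
      also have "\<dots> \<le> envelope n t" using decay_le_envelope[OF assms, of t] by simp
      finally show "cmod (poly R (cis t)) \<le> envelope n t" .
    qed auto
    also have "\<dots> \<le> integral {-pi..pi} (envelope n) / 1"
      using integral_envelope(1)[OF assms] pi_gt3 by (intro divide_left_mono) auto
    finally show ?thesis by simp
  qed
  ultimately show ?thesis using order_trans[OF abs_Re_le_cmod[of "coeff R j"]] by simp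
qed

lemma sup_error_moment:
  "\<exists>K>0. \<forall>n\<ge>2. mean n (\<lambda>E. sup_error n E ^ (2 * Suc p))
     \<le> (K * integral {-pi..pi} (envelope n)) ^ (2 * Suc p)"
proof -
  obtain K where K: "K > 0" and moment: "\<And>n t. n \<ge> 1 \<Longrightarrow> \<bar>t\<bar> \<le> pi \<Longrightarrow>
     mean n (\<lambda>E. cmod (remainder n E (cis t)) ^ (2 * Suc p))
       \<le> (K * (t\<^sup>2 * real n powr decay_exponent t)) ^ (2 * Suc p)"
    using remainder_moment[of p] by blast
  have "mean n (\<lambda>E. sup_error n E ^ (2 * Suc p)) \<le> (K * integral {-pi..pi} (envelope n)) ^ (2 * Suc p)"
    if n: "n \<ge> 2" for n
  proof -
    define q where "q = Suc (2 * p)"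
    have q: "2 * Suc p = Suc q" by (simp add: q_def)
    have "mean n (\<lambda>E. sup_error n E ^ Suc q)
        \<le> mean n (\<lambda>E. integral {-pi..pi} (\<lambda>t. cmod (remainder n E (cis t))) ^ Suc q)"
    proof (intro mean_mono power_mono sup_error_nonneg)
      fix E
      have "integral {-pi..pi} (\<lambda>t. cmod (remainder n E (cis t))) / (2 * pi)
          \<le> integral {-pi..pi} (\<lambda>t. cmod (remainder n E (cis t))) / 1"
        using pi_gt3 by (intro divide_left_mono integral_nonneg integrable_continuous_real continuous_on_remainder) auto
      thus "sup_error n E \<le> integral {-pi..pi} (\<lambda>t. cmod (remainder n E (cis t)))"
        by (simp add: sup_error_def)
    qed
    also have "\<dots> \<le> (K * integral {-pi..pi} (envelope n)) ^ Suc q"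
    proof (rule mean_integral_power_le)
      fix t assume t: "t \<in> {-pi..pi}"
      have "mean n (\<lambda>E. cmod (remainder n E (cis t)) ^ Suc q)
          \<le> (K * (t\<^sup>2 * real n powr decay_exponent t)) ^ Suc q"
        unfolding q[symmetric] using n t by (intro moment) auto
      also have "\<dots> \<le> (K * envelope n t) ^ Suc q"
        using K decay_le_envelope[OF n, of t] by (intro power_mono mult_left_mono) auto
      finally show "mean n (\<lambda>E. cmod (remainder n E (cis t)) ^ Suc q) \<le> (K * envelope n t) ^ Suc q" .
    qed (use n K continuous_on_remainder continuous_on_envelope envelope_pos integral_envelope(1) in auto)
    finally show ?thesis unfolding q .
  qed
  with K show ?thesis by blast
qed

lemma mu_max_exists:
  assumes "n \<ge> 1"
  obtains k0 :: nat where "\<And>k. mu n k \<le> mu n (int k0)"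
proof -
  define d where "d = degree (mu_poly n)"
  have fin: "finite (mu n ` int ` {..d})" "mu n ` int ` {..d} \<noteq> {}" by auto
  obtain k0 where k0: "Max (mu n ` int ` {..d}) = mu n (int k0)"
    using Max_in[OF fin] by (metis imageE)
  have le: "mu n (int k) \<le> mu n (int k0)" if "k \<le> d" for k
    unfolding k0[symmetric] using that fin by (intro Max_ge) auto
  \<comment> \<open>A value 1 at level 0 makes the maximum nonnegative, so the zeros outside the
    degree range cannot exceed it.\<close>
  have "coeff (mu_poly n) 0 = 1"
    by (simp add: poly_0_coeff_0[symmetric] poly_mu_poly mean_poly_def)
  hence "mu n (int 0) = 1" by (simp add: mu_def)
  with le[of 0] have pos: "0 \<le> mu n (int k0)" by simp
  have "mu n k \<le> mu n (int k0)" for k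
  proof (cases "0 \<le> k \<and> nat k \<le> d")
    case True
    thus ?thesis using le[of "nat k"] by simp
  next
    case False
    hence "mu n k = 0" by (auto simp: mu_def d_def coeff_eq_0)
    thus ?thesis using pos by simp
  qed
  thus ?thesis by (rule that)
qed

text \<open>M is the maximum of \<open>mu n\<close>. From above, the linear term is a tangent
  extrapolation. From below, the level where \<open>mu n\<close> is maximal suffices, because the
  slope there is at most of the size of a second difference.\<close>

lemma width_approx:
  assumes "n \<ge> 2"
  shows "\<exists>M. \<forall>E. \<bar>real (width n E) - M\<bar>
    \<le> sup_error n E + 2 * integral {-pi..pi} (envelope n) * (1 + (depth_dev n E)\<^sup>2)"
proof -
  define D where "D = integral {-pi..pi} (envelope n)"
  have D: "D > 0" unfolding D_def by (rule integral_envelope(1)[OF assms])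
  have diff2: "\<bar>mu n k - 2 * mu n (k - 1) + mu n (k - 2)\<bar> \<le> D" for k
    unfolding D_def by (rule mu_second_difference[OF assms])
  obtain k0 where k0: "\<And>k. mu n k \<le> mu n (int k0)"
    using mu_max_exists[of n] assms by auto
  define M where "M = mu n (int k0)"
  have "\<bar>real (width n E) - M\<bar> \<le> sup_error n E + 2 * D * (1 + (depth_dev n E)\<^sup>2)" for E
  proof -
    define m where "m = depth_dev n E"
    note fin = width_Max_well_defined[of n E]
    obtain k where "width n E = profile n E k"
      using Max_in[OF fin] unfolding width_def by auto
    moreover have "mu n (int k) - m * (mu n (int k) - mu n (int k - 1)) \<le> M + 2 * D * (1 + m\<^sup>2)"
      unfolding M_def by (intro linear_extrapolation_le diff2 k0)
    ultimately have upper: "real (width n E) \<le> M + sup_error n E + 2 * D * (1 + m\<^sup>2)"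
      using profile_approx[of n E k] unfolding m_def[symmetric] by linarith
    define x where "x = M - mu n (int k0 - 1)"
    \<comment> \<open>As mu(k0 + 1) <= M, the slope M - mu(k0 - 1) is at most minus the second
      difference centred at k0.\<close>
    have x: "0 \<le> x" "x \<le> D"
      using k0[of "int k0 - 1"] k0[of "int k0 + 1"] diff2[of "int k0 + 1"]
      by (simp_all add: x_def M_def)
    have "profile n E k0 \<le> width n E" unfolding width_def using fin by (intro Max_ge) auto
    moreover have "M - m * x - sup_error n E \<le> real (profile n E k0)"
      using profile_approx[of n E k0] unfolding m_def[symmetric] M_def[symmetric] x_def[symmetric]
      by linarith
    moreover have "m * x \<le> 2 * D * (1 + m\<^sup>2)"
    proof -
      have "m * x \<le> \<bar>m\<bar> * D" using x by (intro mult_mono) auto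
      also have "\<dots> \<le> (2 * (1 + m\<^sup>2)) * D"
        using D zero_le_power2[of "1 - \<bar>m\<bar>"]
        by (intro mult_right_mono) (auto simp: power2_eq_square algebra_simps)
      finally show ?thesis by (simp add: mult_ac)
    qed
    ultimately have "M - sup_error n E - 2 * D * (1 + m\<^sup>2) \<le> real (width n E)" by linarith
    with upper show ?thesis unfolding m_def by linarith
  qed
  thus ?thesis unfolding D_def by blast
qed

section \<open>Central moments of the width\<close>

lemma mean_power_le:
  assumes "n \<ge> 1" "\<And>E. g E \<ge> 0"
  shows "mean n g ^ Suc q \<le> mean n (\<lambda>E. g E ^ Suc q)"
proof -
  let ?a = "mean n g" let ?c = "real (Suc q) * ?a ^ q"
  have "mean n (\<lambda>E. ?a ^ Suc q + ?c * (g E + - ?a)) \<le> mean n (\<lambda>E. g E ^ Suc q)"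
  proof (rule mean_mono)
    fix E
    show "?a ^ Suc q + ?c * (g E + - ?a) \<le> g E ^ Suc q"
      using power_ge_tangent[of "g E" ?a q] assms(2)[of E] mean_nonneg[of n g] assms(2) by simp
  qed
  thus ?thesis unfolding mean_add mean_cmult mean_const[OF assms(1)] by simp
qed

lemma width_moment_about:
  "\<exists>K>0. \<forall>n\<ge>3. \<exists>M. mean n (\<lambda>E. \<bar>real (width n E) - M\<bar> ^ (2 * Suc p))
     \<le> K * (real n * ln n powr (-3/2)) ^ (2 * Suc p)"
proof -
  define r where "r = 2 * Suc p"
  obtain K1 where K1: "K1 > 0" "\<And>n. n \<ge> 2 \<Longrightarrow> mean n (\<lambda>E. sup_error n E ^ r)
      \<le> (K1 * integral {-pi..pi} (envelope n)) ^ r"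
    using sup_error_moment[of p] unfolding r_def by blast
  \<comment> \<open>The cost of the shift is quadratic in \<open>depth_dev\<close>, so a moment of
    order 2 r is needed for it.\<close>
  obtain K2 where K2: "K2 > 0" "\<And>n. n \<ge> 1 \<Longrightarrow> mean n (\<lambda>E. depth_dev n E ^ (2 * Suc (2 * p + 1))) \<le> K2"
    using depth_dev_moment[of "2 * p + 1"] by blast
  define c where "c = 96 * pi * sqrt 48"
  define K where "K = 3 ^ r * ((K1 * c) ^ r + (2 * c) ^ r + (2 * c) ^ r * K2)"
  have c: "c > 0" by (simp add: c_def)
  have "\<exists>M. mean n (\<lambda>E. \<bar>real (width n E) - M\<bar> ^ r) \<le> K * (real n * ln n powr (-3/2)) ^ r"
    if n: "n \<ge> 3" for n
  proof -
    define D where "D = integral {-pi..pi} (envelope n)"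
    define b where "b = real n * ln n powr (-3/2)"
    have D: "D > 0" "D \<le> c * b"
      using integral_envelope[of n] n by (auto simp: D_def c_def b_def)
    obtain M where M: "\<And>E. \<bar>real (width n E) - M\<bar> \<le> sup_error n E + 2 * D * (1 + (depth_dev n E)\<^sup>2)"
      using width_approx[of n] n unfolding D_def by auto
    have "mean n (\<lambda>E. \<bar>real (width n E) - M\<bar> ^ r)
        \<le> mean n (\<lambda>E. 3 ^ r * (sup_error n E ^ r + (2 * D) ^ r + (2 * D) ^ r * depth_dev n E ^ (2 * Suc (2 * p + 1))))"
    proof (rule mean_mono)
      fix E
      have "\<bar>real (width n E) - M\<bar> \<le> sup_error n E + 2 * D + 2 * D * (depth_dev n E)\<^sup>2"
        using M[of E] by (simp add: algebra_simps)
      hence "\<bar>real (width n E) - M\<bar> ^ r \<le> (sup_error n E + 2 * D + 2 * D * (depth_dev n E)\<^sup>2) ^ r"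
        by (intro power_mono) auto
      also have "\<dots> \<le> 3 ^ r * (sup_error n E ^ r + (2 * D) ^ r + (2 * D * (depth_dev n E)\<^sup>2) ^ r)"
        using D sup_error_nonneg by (intro power_sum3_le) auto
      also have "(2 * D * (depth_dev n E)\<^sup>2) ^ r = (2 * D) ^ r * depth_dev n E ^ (2 * Suc (2 * p + 1))"
      proof -
        have "((depth_dev n E)\<^sup>2) ^ r = depth_dev n E ^ (2 * Suc (2 * p + 1))"
        proof -
          have "2 * r = 2 * Suc (2 * p + 1)" by (simp add: r_def)
          thus ?thesis by (metis power_mult)
        qed
        thus ?thesis by (simp only: power_mult_distrib)
      qed
      finally show "\<bar>real (width n E) - M\<bar> ^ r
          \<le> 3 ^ r * (sup_error n E ^ r + (2 * D) ^ r + (2 * D) ^ r * depth_dev n E ^ (2 * Suc (2 * p + 1)))" .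
    qed
    also have "\<dots> = 3 ^ r * (mean n (\<lambda>E. sup_error n E ^ r) + (2 * D) ^ r
        + (2 * D) ^ r * mean n (\<lambda>E. depth_dev n E ^ (2 * Suc (2 * p + 1))))"
      unfolding mean_add mean_cmult using n by (subst mean_const) auto
    also have "\<dots> \<le> 3 ^ r * ((K1 * D) ^ r + (2 * D) ^ r + (2 * D) ^ r * K2)"
      using K1(2)[of n] K2(2)[of n] n D
      by (intro mult_left_mono add_mono order_refl) (auto simp: D_def)
    also have "\<dots> = 3 ^ r * (K1 ^ r + 2 ^ r + 2 ^ r * K2) * D ^ r"
      by (simp add: power_mult_distrib algebra_simps)
    also have "\<dots> \<le> 3 ^ r * (K1 ^ r + 2 ^ r + 2 ^ r * K2) * (c * b) ^ r"
      using D K1 K2 by (intro mult_left_mono power_mono) auto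
    also have "\<dots> = K * b ^ r"
      by (simp add: K_def power_mult_distrib algebra_simps)
    finally show ?thesis unfolding b_def by blast
  qed
  moreover have "K > 0" unfolding K_def using c K1 K2 by (intro mult_pos_pos add_pos_pos) auto
  ultimately show ?thesis unfolding r_def by blast
qed

text \<open>By Jensen the mean is no farther from a centre M than the moment norm about M, so
  recentring costs a constant factor.\<close>

lemma width_central_moment:
  "\<exists>K>0. \<forall>n\<ge>3. mean n (\<lambda>E. \<bar>real (width n E) - mean n (\<lambda>E. real (width n E))\<bar> ^ (2 * Suc p))
     \<le> K * (real n * ln n powr (-3/2)) ^ (2 * Suc p)"
proof -
  define q where "q = Suc (2 * p)"
  have q: "2 * Suc p = Suc q" by (simp add: q_def)
  obtain K where K: "K > 0" "\<And>n. n \<ge> 3 \<Longrightarrow> \<exists>M. mean n (\<lambda>E. \<bar>real (width n E) - M\<bar> ^ Suc q)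
     \<le> K * (real n * ln n powr (-3/2)) ^ Suc q"
    using width_moment_about[of p] unfolding q by blast
  have "mean n (\<lambda>E. \<bar>real (width n E) - mean n (\<lambda>E. real (width n E))\<bar> ^ Suc q)
     \<le> (3 ^ Suc q * (2 * K)) * (real n * ln n powr (-3/2)) ^ Suc q" if n: "n \<ge> 3" for n
  proof -
    define w where "w = mean n (\<lambda>E. real (width n E))"
    obtain M where M: "mean n (\<lambda>E. \<bar>real (width n E) - M\<bar> ^ Suc q)
        \<le> K * (real n * ln n powr (-3/2)) ^ Suc q"
      using K(2)[OF n] by blast
    define g where "g E = \<bar>real (width n E) - M\<bar>" for E
    have n1: "n \<ge> 1" using n by simp
    have "\<bar>w - M\<bar> \<le> mean n g"
    proof -
      have "mean n (\<lambda>E. real (width n E) + - M) \<le> mean n g"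
        "mean n (\<lambda>E. M + (-1) * real (width n E)) \<le> mean n g"
        by (intro mean_mono; simp add: g_def)+
      thus ?thesis unfolding mean_add mean_cmult mean_const[OF n1] w_def by linarith
    qed
    hence "\<bar>w - M\<bar> ^ Suc q \<le> mean n g ^ Suc q" by (intro power_mono) auto
    also have "\<dots> \<le> mean n (\<lambda>E. g E ^ Suc q)"
      by (rule mean_power_le[OF n1]) (simp add: g_def)
    finally have wM: "\<bar>w - M\<bar> ^ Suc q \<le> mean n (\<lambda>E. g E ^ Suc q)" .
    have "mean n (\<lambda>E. \<bar>real (width n E) - w\<bar> ^ Suc q)
        \<le> mean n (\<lambda>E. 3 ^ Suc q * (g E ^ Suc q + \<bar>w - M\<bar> ^ Suc q))"
    proof (rule mean_mono)
      fix E
      have "\<bar>real (width n E) - w\<bar> ^ Suc q \<le> (g E + \<bar>w - M\<bar> + 0) ^ Suc q"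
        by (intro power_mono) (auto simp: g_def)
      also have "\<dots> \<le> 3 ^ Suc q * (g E ^ Suc q + \<bar>w - M\<bar> ^ Suc q + 0 ^ Suc q)"
        by (intro power_sum3_le) (auto simp: g_def)
      finally show "\<bar>real (width n E) - w\<bar> ^ Suc q \<le> 3 ^ Suc q * (g E ^ Suc q + \<bar>w - M\<bar> ^ Suc q)"
        by simp
    qed
    also have "\<dots> = 3 ^ Suc q * (mean n (\<lambda>E. g E ^ Suc q) + \<bar>w - M\<bar> ^ Suc q)"
      unfolding mean_add mean_cmult mean_const[OF n1] ..
    also have "\<dots> \<le> 3 ^ Suc q * (2 * (K * (real n * ln n powr (-3/2)) ^ Suc q))"
      using wM M unfolding g_def by (intro mult_left_mono) auto
    finally show ?thesis unfolding w_def by (simp add: mult_ac)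
  qed
  moreover have "3 ^ Suc q * (2 * K) > 0" using K by simp
  ultimately show ?thesis unfolding q by blast
qed

section \<open>From even orders to real exponents\<close>

lemma rpow_nonneg: "rpow x s \<ge> 0"
  by (simp add: rpow_def)

text \<open>For x <= b the left side is at most b^s; beyond b the larger exponent r takes over. At s
  = 0 both \<open>rpow\<close> terms are 1 by convention.\<close>

lemma rpow_le_add_power:
  assumes "x \<ge> 0" "b > 0" "0 \<le> s" "s \<le> real r"
  shows "rpow x s \<le> rpow b s * (1 + (x / b) ^ r)"
proof (cases "s = 0")
  case True
  thus ?thesis using assms by (simp add: rpow_def)
next
  case False
  have "(x / b) powr s \<le> 1 + (x / b) ^ r"
  proof (cases "x / b \<le> 1")
    case True
    hence "(x / b) powr s \<le> 1" using assms by (intro powr_le1) auto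
    moreover have "0 \<le> (x / b) ^ r" using assms by simp
    ultimately show ?thesis by linarith
  next
    case False
    hence "(x / b) powr s \<le> (x / b) powr real r" using assms by (intro powr_mono) auto
    also have "\<dots> = (x / b) ^ r" using False by (intro powr_realpow) auto
    finally show ?thesis by simp
  qed
  hence "b powr s * (x / b) powr s \<le> b powr s * (1 + (x / b) ^ r)" by (intro mult_left_mono) auto
  moreover have "b powr s * (x / b) powr s = x powr s"
    using assms by (subst powr_mult[symmetric]) auto
  ultimately show ?thesis using False by (simp add: rpow_def)
qed

theorem theorem1p2:
  fixes s :: real
  assumes "s \<ge> 0"
  shows "(\<lambda>n. measure_pmf.expectation (random_recursive_tree n)
                (\<lambda>E. rpow \<bar>real (width n E) - expected_width n\<bar> s))
           \<in> O(\<lambda>n. rpow (real n) s * L n powr (- 3 * s / 2))"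
proof -
  define p where "p = nat \<lceil>s\<rceil>"
  define r where "r = 2 * Suc p"
  have r: "s \<le> real r" using real_nat_ceiling_ge[of s] by (simp add: r_def p_def)
  obtain K where K: "K > 0" "\<And>n. n \<ge> 3 \<Longrightarrow>
      mean n (\<lambda>E. \<bar>real (width n E) - mean n (\<lambda>E. real (width n E))\<bar> ^ r)
        \<le> K * (real n * ln n powr (-3/2)) ^ r"
    using width_central_moment[of p] unfolding r_def by blast
  show ?thesis
  proof (rule bigoI[where c = "1 + K"], rule eventually_mono[OF eventually_ge_at_top[of 3]])
    fix n :: nat
    assume n: "n \<ge> 3"
    have n1: "n \<ge> 1" using n by simp
    define b where "b = real n * ln n powr (-3/2)"
    have b: "b > 0" using n by (simp add: b_def)
    define x where "x E = \<bar>real (width n E) - mean n (\<lambda>E. real (width n E))\<bar>" for E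
    \<comment> \<open>As e <= 3 <= n, the truncation in \<open>L\<close> is inactive; hence the
      start at n = 3.\<close>
    have "ln (real n) \<ge> 1"
      using n exp_le by (subst ln_ge_iff) auto
    hence L: "L n = ln (real n)" by (simp add: L_def)
    have rb: "rpow b s = rpow (real n) s * L n powr (- 3 * s / 2)"
      using n by (simp add: rpow_def b_def L powr_mult powr_powr)
    have "mean n (\<lambda>E. rpow (x E) s) \<le> mean n (\<lambda>E. rpow b s * (1 + (1 / b ^ r) * x E ^ r))"
      using rpow_le_add_power[OF _ b assms r]
      by (intro mean_mono) (simp add: x_def power_divide)
    also have "\<dots> = rpow b s * (1 + (1 / b ^ r) * mean n (\<lambda>E. x E ^ r))"
      unfolding mean_cmult mean_add mean_const[OF n1] ..
    also have "\<dots> \<le> rpow b s * (1 + (1 / b ^ r) * (K * b ^ r))"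
      using K(2)[OF n] b rpow_nonneg unfolding x_def b_def[symmetric]
      by (intro mult_left_mono add_left_mono) auto
    also have "\<dots> = (1 + K) * rpow b s" using b by (simp add: field_simps)
    finally have "mean n (\<lambda>E. rpow (x E) s) \<le> (1 + K) * (rpow (real n) s * L n powr (- 3 * s / 2))"
      unfolding rb .
    moreover have "mean n (\<lambda>E. rpow (x E) s) \<ge> 0" by (intro mean_nonneg rpow_nonneg)
    moreover have "measure_pmf.expectation (random_recursive_tree n)
        (\<lambda>E. rpow \<bar>real (width n E) - expected_width n\<bar> s) = mean n (\<lambda>E. rpow (x E) s)"
      unfolding expectation_eq_mean[OF n1] expected_width_def x_def ..
    moreover have "rpow (real n) s * L n powr (- 3 * s / 2) \<ge> 0" by (simp add: rpow_nonneg)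
    ultimately show "norm (measure_pmf.expectation (random_recursive_tree n)
        (\<lambda>E. rpow \<bar>real (width n E) - expected_width n\<bar> s))
      \<le> (1 + K) * norm (rpow (real n) s * L n powr (- 3 * s / 2))"
      by simp
  qed
qed

end
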